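(* Fix $\tau,\tau'\in i\mathbb R$. For $\lambda\in i\mathbb R$ set $k_\lambda:=|l^{mod}_\lambda(e_\tau\otimes e_{\tau'}\otimes e_\lambda)|^2$, where $l^{mod}_\lambda=l^{mod}_{\tau,\tau',\lambda}$ is the model invariant trilinear functional on $V_\tau\otimes V_{\tau'}\otimes V_\lambda$. Then there exists a constant $c>0$ such that $$k_\lambda=c\,\exp\Big(-\frac{\pi}{2}|\lambda|\Big)\cdot|\lambda|^{-2}\,\big(1+O(|\lambda|^{-1})\big)$$ as $|\lambda|\to\infty$, $\lambda\in i\mathbb R$.
   Context: For $\lambda\in\mathbb C$, $V_\lambda$ is the space of smooth functions $f$ on $\mathbb R^2\setminus 0$ with $f(ax,ay)=|a|^{\lambda-1}f(x,y)$ for all $a\in\mathbb R\setminus 0$; restriction to the unit circle identifies $V_\lambda$ with the space $C^\infty(S^1)^{even}$ of even smooth functions on $S^1$ (circle model). The vector $e_\lambda\in V_\lambda$ is the function equal to $1$ on the unit circle. For $\lambda_1,\lambda_2,\lambda_3\in\mathbb C$ put $\alpha=\lambda_1-\lambda_2-\lambda_3$, $\beta=-\lambda_1+\lambda_2-\lambda_3$, $\gamma=-\lambda_1-\lambda_2+\lambda_3$. In the circle model, the model trilinear functional $l^{mod}_{\lambda_1,\lambda_2,\lambda_3}:V_{\lambda_1}\otimes V_{\lambda_2}\otimes V_{\lambda_3}\to\mathbb C$ is $$l^{mod}_{\lambda_1,\lambda_2,\lambda_3}(f_1\otimes f_2\otimes f_3)=(2\pi)^{-3}\int_0^{2\pi}\!\!\int_0^{2\pi}\!\!\int_0^{2\pi}f_1(x)f_2(y)f_3(z)\,|\sin(y-z)|^{\frac{\alpha-1}{2}}|\sin(x-z)|^{\frac{\beta-1}{2}}|\sin(x-y)|^{\frac{\gamma-1}{2}}\,dx\,dy\,dz,$$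 where $x,y,z$ are the standard angular parameters on the circle; this integral converges absolutely when all $\lambda_j\in i\mathbb R$. *)

theory Defs
  imports "HOL-Analysis.Analysis" "HOL-Library.Landau_Symbols"
begin

text \<open>
  Being of class \<open>C\<^sup>k\<close> on an open set, by recursion on \<open>k\<close> through the directional derivatives.
  This is meaningful for open sets only.
\<close>

primrec k_times_cont_diff_on ::
  "nat \<Rightarrow> 'a::euclidean_space set \<Rightarrow> ('a \<Rightarrow> 'b::real_normed_vector) \<Rightarrow> bool" where
  "k_times_cont_diff_on 0 S f \<longleftrightarrow> continuous_on S f"
| "k_times_cont_diff_on (Suc k) S f \<longleftrightarrow>
     (\<forall>x\<in>S. f differentiable at x) \<and>
     (\<forall>v. k_times_cont_diff_on k S (\<lambda>x. frechet_derivative f (at x) v))"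

definition smooth_on :: "'a::euclidean_space set \<Rightarrow> ('a \<Rightarrow> 'b::real_normed_vector) \<Rightarrow> bool" where
  "smooth_on S f \<longleftrightarrow> (\<forall>k. k_times_cont_diff_on k S f)"

text \<open>
  A function on the punctured plane is represented by a total function that is \<open>0\<close> at the
  origin, so that equality of elements of \<open>V_space \<mu>\<close> is equality of functions.
\<close>

definition V_space :: "complex \<Rightarrow> (real \<times> real \<Rightarrow> complex) set" where
  "V_space \<mu> = {f. smooth_on (- {0}) f \<and> f 0 = 0 \<and>
     (\<forall>a x y. a \<noteq> 0 \<and> (x, y) \<noteq> 0 \<longrightarrow>
        f (a * x, a * y) = complex_of_real \<bar>a\<bar> powr (\<mu> - 1) * f (x, y))}"

definition e_vec :: "complex \<Rightarrow> real \<times> real \<Rightarrow> complex" where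
  "e_vec \<mu> = (THE f. f \<in> V_space \<mu> \<and> (\<forall>v. norm v = 1 \<longrightarrow> f v = 1))"

definition circle_model :: "(real \<times> real \<Rightarrow> complex) \<Rightarrow> real \<Rightarrow> complex" where
  "circle_model f \<theta> = f (cos \<theta>, sin \<theta>)"

text \<open>
  The functional is given as a function of three arguments, i.e. by its values on the pure tensors.
  The kernel takes the value \<open>0\<close> where one of the sines vanishes, since \<open>0 powr s = 0\<close>.
\<close>

definition l_mod :: "complex \<Rightarrow> complex \<Rightarrow> complex \<Rightarrow>
    (real \<times> real \<Rightarrow> complex) \<Rightarrow> (real \<times> real \<Rightarrow> complex) \<Rightarrow> (real \<times> real \<Rightarrow> complex) \<Rightarrow> complex" where
  "l_mod \<mu>\<^sub>1 \<mu>\<^sub>2 \<mu>\<^sub>3 f\<^sub>1 f\<^sub>2 f\<^sub>3 =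
    (let \<alpha> = \<mu>\<^sub>1 - \<mu>\<^sub>2 - \<mu>\<^sub>3; \<beta> = - \<mu>\<^sub>1 + \<mu>\<^sub>2 - \<mu>\<^sub>3; \<gamma> = - \<mu>\<^sub>1 - \<mu>\<^sub>2 + \<mu>\<^sub>3 in
      1 / complex_of_real (2 * pi) ^ 3 *
      (LINT z:{0..2*pi}|lborel. LINT y:{0..2*pi}|lborel. LINT x:{0..2*pi}|lborel.
         circle_model f\<^sub>1 x * circle_model f\<^sub>2 y * circle_model f\<^sub>3 z *
         complex_of_real \<bar>sin (y - z)\<bar> powr ((\<alpha> - 1) / 2) *
         complex_of_real \<bar>sin (x - z)\<bar> powr ((\<beta> - 1) / 2) *
         complex_of_real \<bar>sin (x - y)\<bar> powr ((\<gamma> - 1) / 2)))"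

definition k_coeff :: "complex \<Rightarrow> complex \<Rightarrow> complex \<Rightarrow> real" where
  "k_coeff \<tau> \<tau>' \<mu> = (cmod (l_mod \<tau> \<tau>' \<mu> (e_vec \<tau>) (e_vec \<tau>') (e_vec \<mu>)))\<^sup>2"

definition at_imag_infinity :: "complex filter" where
  "at_imag_infinity = inf at_infinity (principal {\<mu>. Re \<mu> = 0})"

text \<open>
  The rest of the theory shows that \<open>e_vec \<mu>\<close> is well defined and computes it.
\<close>

lemma k_times_cont_diff_on_cong:
  assumes "open S" "\<And>x. x \<in> S \<Longrightarrow> f x = g x" "k_times_cont_diff_on n S f"
  shows "k_times_cont_diff_on n S g"
  using assms(2,3)
proof (induction n arbitrary: f g)
  case 0
  then show ?case by (metis continuous_on_cong k_times_cont_diff_on.simps(1))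
next
  case (Suc n)
  have *: "g differentiable at x \<and> frechet_derivative g (at x) = frechet_derivative f (at x)"
    if "x \<in> S" for x
  proof -
    have "(f has_derivative frechet_derivative f (at x)) (at x)"
      using Suc.prems(2) that by (simp add: frechet_derivative_works[symmetric])
    then have "(g has_derivative frechet_derivative f (at x)) (at x)"
      by (rule has_derivative_transform_within_open[OF _ assms(1) that]) (use Suc.prems in auto)
    then show ?thesis
      by (metis differentiableI frechet_derivative_at)
  qed
  have "k_times_cont_diff_on n S (\<lambda>x. frechet_derivative g (at x) v)" for v
    by (rule Suc.IH[of "\<lambda>x. frechet_derivative f (at x) v"]) (use * Suc.prems(2) in auto)
  with * show ?case by auto
qed

text \<open>
  A class of functions closed under directional derivatives that contains the powers of the norm.
\<close>

inductive elementary :: "(real \<times> real \<Rightarrow> complex) \<Rightarrow> bool" where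
  linear: "elementary (\<lambda>v. complex_of_real (v \<bullet> w))"
| const: "elementary (\<lambda>v. c)"
| pow: "elementary (\<lambda>v. complex_of_real (v \<bullet> v) powr s)"
| add: "elementary f \<Longrightarrow> elementary g \<Longrightarrow> elementary (\<lambda>v. f v + g v)"
| mult: "elementary f \<Longrightarrow> elementary g \<Longrightarrow> elementary (\<lambda>v. f v * g v)"

lemma elementary_deriv:
  assumes "elementary f"
  shows "\<exists>f'. (\<forall>x\<noteq>0. (f has_derivative f' x) (at x)) \<and> (\<forall>v. elementary (\<lambda>x. f' x v))"
  using assms
proof induction
  case (linear w)
  have "((\<lambda>v. complex_of_real (v \<bullet> w)) has_derivative (\<lambda>v. complex_of_real (v \<bullet> w))) (at x)" for x
    by (auto intro!: derivative_eq_intros)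
  then show ?case by (intro exI[of _ "\<lambda>_ v. complex_of_real (v \<bullet> w)"]) (auto intro: elementary.intros)
next
  case (const c)
  then show ?case by (intro exI[of _ "\<lambda>_ _. 0"]) (auto intro: elementary.intros)
next
  case (pow s)
  have "((\<lambda>v. complex_of_real (v \<bullet> v) powr s) has_derivative
      (\<lambda>v. s * complex_of_real (x \<bullet> x) powr (s - 1) * (2 * complex_of_real (x \<bullet> v)))) (at x)"
    if "x \<noteq> 0" for x :: "real \<times> real"
  proof -
    have 1: "((\<lambda>v. complex_of_real (v \<bullet> v)) has_derivative (\<lambda>v. 2 * complex_of_real (x \<bullet> v))) (at x)"
      by (auto intro!: derivative_eq_intros simp: inner_commute)
    have 2: "((\<lambda>z. z powr s) has_derivative (\<lambda>h. s * complex_of_real (x \<bullet> x) powr (s - 1) * h))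
        (at (complex_of_real (x \<bullet> x)))"
      using that by (intro has_field_derivative_powr[unfolded has_field_derivative_def])
        (simp add: complex_nonpos_Reals_iff not_le)
    show ?thesis
      using has_derivative_compose[OF 1 2] by simp
  qed
  moreover have "elementary (\<lambda>x. s * complex_of_real (x \<bullet> x) powr (s - 1) * (2 * complex_of_real (x \<bullet> v)))" for v
    by (intro elementary.intros)
  ultimately show ?case
    by (intro exI[of _ "\<lambda>x v. s * complex_of_real (x \<bullet> x) powr (s - 1) * (2 * complex_of_real (x \<bullet> v))"]) auto
next
  case (add f g)
  then obtain f' g' where "\<forall>x\<noteq>0. (f has_derivative f' x) (at x)" "\<forall>v. elementary (\<lambda>x. f' x v)"
    "\<forall>x\<noteq>0. (g has_derivative g' x) (at x)" "\<forall>v. elementary (\<lambda>x. g' x v)" by blast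
  then show ?case
    by (intro exI[of _ "\<lambda>x v. f' x v + g' x v"]) (auto intro: elementary.intros has_derivative_add)
next
  case (mult f g)
  then obtain f' g' where "\<forall>x\<noteq>0. (f has_derivative f' x) (at x)" "\<forall>v. elementary (\<lambda>x. f' x v)"
    "\<forall>x\<noteq>0. (g has_derivative g' x) (at x)" "\<forall>v. elementary (\<lambda>x. g' x v)" by blast
  then show ?case
    using mult.hyps
    by (intro exI[of _ "\<lambda>x v. f x * g' x v + f' x v * g x"])
      (auto intro!: elementary.add elementary.mult has_derivative_mult)
qed

lemma elementary_smooth:
  assumes "elementary f"
  shows "smooth_on (- {0}) f"
proof -
  have "k_times_cont_diff_on n (- {0}) f" for n
    using assms
  proof (induction n arbitrary: f)
    case 0
    obtain f' where "\<forall>x\<noteq>0. (f has_derivative f' x) (at x)"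
      using elementary_deriv[OF 0] by blast
    then have "continuous_on (- {0}) f"
      by (intro continuous_at_imp_continuous_on) (metis ComplD has_derivative_continuous insertI1)
    then show ?case by simp
  next
    case (Suc n)
    obtain f' where f': "\<forall>x\<noteq>0. (f has_derivative f' x) (at x)" "\<forall>v. elementary (\<lambda>x. f' x v)"
      using elementary_deriv[OF Suc.prems] by blast
    have eq: "f' x v = frechet_derivative f (at x) v" if "x \<in> - {0}" for x v
      using f'(1) that by (metis ComplD frechet_derivative_at insertI1)
    have "k_times_cont_diff_on n (- {0}) (\<lambda>x. frechet_derivative f (at x) v)" for v
      by (rule k_times_cont_diff_on_cong[OF _ eq Suc.IH[OF f'(2)[rule_format]]]) auto
    moreover have "f differentiable at x" if "x \<in> - {0}" for x
      using f'(1) that by (metis ComplD differentiableI insertI1)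
    ultimately show ?case by simp
  qed
  then show ?thesis by (simp add: smooth_on_def)
qed

lemma norm_powr_in_V_space: "(\<lambda>v. complex_of_real (norm v) powr (\<mu> - 1)) \<in> V_space \<mu>"
proof -
  have eq: "complex_of_real (norm v) powr s = complex_of_real (v \<bullet> v) powr (s / 2)"
    for v :: "real \<times> real" and s
  proof (cases "v = 0")
    case False
    then have "complex_of_real (ln (v \<bullet> v)) = 2 * complex_of_real (ln (norm v))"
      by (simp add: power2_norm_eq_inner[symmetric] ln_realpow)
    with False show ?thesis
      by (simp add: powr_def Ln_of_real)
  qed auto
  have "smooth_on (- {0}) (\<lambda>v::real \<times> real. complex_of_real (norm v) powr (\<mu> - 1))"
    unfolding eq by (intro elementary_smooth elementary.intros)
  moreover have "complex_of_real (norm (a * x, a * y)) powr (\<mu> - 1) =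
      complex_of_real \<bar>a\<bar> powr (\<mu> - 1) * complex_of_real (norm (x, y)) powr (\<mu> - 1)" for a x y :: real
  proof -
    have "norm (a * x, a * y) = \<bar>a\<bar> * norm (x, y)"
      using norm_scaleR[of a "(x, y)"] by simp
    then show ?thesis by (simp add: powr_times_real)
  qed
  ultimately show ?thesis by (simp add: V_space_def)
qed

lemma e_vec_unique:
  assumes "f \<in> V_space \<mu>" "\<forall>v. norm v = 1 \<longrightarrow> f v = 1"
  shows "f = (\<lambda>v. complex_of_real (norm v) powr (\<mu> - 1))"
proof
  fix v :: "real \<times> real"
  show "f v = complex_of_real (norm v) powr (\<mu> - 1)"
  proof (cases "v = 0")
    case True
    with assms show ?thesis by (simp add: V_space_def)
  next
    case False
    define u where "u = v /\<^sub>R norm v"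
    have u: "norm u = 1" and v: "v = norm v *\<^sub>R u" using False by (auto simp: u_def)
    obtain x y where xy: "u = (x, y)" by (cases u)
    have "u \<noteq> 0" using u by auto
    then have "f (norm v * x, norm v * y) = complex_of_real \<bar>norm v\<bar> powr (\<mu> - 1) * f (x, y)"
      using assms(1) False xy unfolding V_space_def by fastforce
    moreover have "(norm v * x, norm v * y) = v" using v xy by (metis scaleR_Pair real_scaleR_def)
    ultimately show ?thesis using assms(2) u xy by simp
  qed
qed

lemma e_vec_eq: "e_vec \<mu> = (\<lambda>v. complex_of_real (norm v) powr (\<mu> - 1))"
  unfolding e_vec_def
proof (rule the_equality)
  show "(\<lambda>v. complex_of_real (norm v) powr (\<mu> - 1)) \<in> V_space \<mu> \<and>
      (\<forall>v::real \<times> real. norm v = 1 \<longrightarrow> complex_of_real (norm v) powr (\<mu> - 1) = 1)"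
    by (simp add: norm_powr_in_V_space)
qed (use e_vec_unique in auto)

end

theory Submission
  imports Defs "HOL-Complex_Analysis.Cauchy_Integral_Theorem"
begin

text \<open>
The values of \<open>l_mod\<close> on the unit vectors have a closed form, and the asymptotics is read off it.

Averaging over one of the three angles leaves a double integral over the circle, because the kernel
depends on differences of angles only. Substituting the tangents \<open>u\<close> and \<open>v\<close> of
the remaining angles, shifted by \<open>\<pi> / 2\<close> so that the coincidences with the third angle go to
infinity, turns it into the integral over the real plane of \<open>(1 + v\<^sup>2) powr (- p) * (1 + u\<^sup>2) powr (- q) * \<bar>u - v\<bar> powr c\<close>
(\<open>circle_double_integral\<close>). Here \<open>(1 + v\<^sup>2) powr (- p) * (1 + u\<^sup>2) powr (- q)\<close> is, up to the
factor \<open>Beta p q\<close>, Feynman's integral over \<open>y > 0\<close> of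
\<open>y powr (q - 1) * ((1 + v\<^sup>2) + y * (1 + u\<^sup>2)) powr (- p - q)\<close>. Exchanging the order of
integration and completing the square, the integrations in \<open>v\<close>, in \<open>w = u - v\<close> and in \<open>y\<close> are all
Beta integrals (\<open>kernel_iterated_integral\<close>). The outcome, \<open>l_mod_e_vec_Gamma\<close>, is
\<open>\<Gamma>(A) \<Gamma>(B) \<Gamma>(C) \<Gamma>(D) / (\<Gamma>((1 - \<mu>\<^sub>1)/2) \<Gamma>((1 - \<mu>\<^sub>2)/2) \<Gamma>((1 - \<mu>\<^sub>3)/2))\<close> up to a constant, where for imaginary
parameters \<open>A\<close>, \<open>B\<close>, \<open>C\<close>, \<open>D\<close> have real part \<open>1/4\<close> and imaginary parts
\<open>(\<plusminus> t\<^sub>1 \<plusminus> t\<^sub>2 \<plusminus> t) / 4\<close>.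

On the line of real part \<open>1/2\<close> the reflection formula gives \<open>\<bar>\<Gamma>(1/2 + i y)\<bar>\<^sup>2 = \<pi> / cosh (\<pi> y)\<close>. On the
line of real part \<open>1/4\<close> it gives only the product \<open>\<bar>\<Gamma>(1/4 + i u) \<Gamma>(3/4 + i u)\<bar>\<close>. The
quotient of the two factors is governed by a convergent infinite product
(\<open>Gamma_half_shift_bound\<close>), and together they yield
\<open>ln \<bar>\<Gamma>(1/4 + i u)\<bar>\<^sup>2 = ln (2 \<pi>) - ln \<bar>u\<bar> / 2 - \<pi> \<bar>u\<bar> + O(1 / \<bar>u\<bar>)\<close>
(\<open>ln_Gamma_line_quarter\<close>), without any appeal to Stirling's formula. For large \<open>\<bar>t\<bar>\<close> the four values
of \<open>\<bar>u\<bar>\<close> add up to exactly \<open>\<bar>t\<bar>\<close>, so the squared modulus of the numerator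
decays like \<open>exp (- \<pi> \<bar>t\<bar>) / t\<^sup>2\<close>, and the
denominator contributes \<open>cosh (\<pi> t / 2)\<close>. Working with logarithms keeps all the error terms additive.
\<close>

section \<open>The half-line and iterated integrals\<close>

text \<open>
Lebesgue measure on the positive reals is realised as a density on the whole line rather than as a
restricted space: its measurable sets are then those of \<open>borel\<close>, which keeps measurability proofs
for products automatic.
\<close>

definition half_line :: "real measure" where
  "half_line = density lborel (\<lambda>t. ennreal (indicator {0<..} t))"

lemma sets_half_line [simp, measurable_cong]: "sets half_line = sets borel"
  by (simp add: half_line_def)

lemma space_half_line [simp]: "space half_line = UNIV"
  by (simp add: half_line_def)

lemma measurable_half_line_iff [simp]: "measurable half_line M = measurable borel M"
  by (rule measurable_cong_sets) auto

interpretation half_line: sigma_finite_measure half_line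
  unfolding half_line_def
  by (subst sigma_finite_measure.sigma_finite_iff_density_finite[OF lborel.sigma_finite_measure_axioms]) (auto simp: indicator_def)

interpretation half_line_pair: pair_sigma_finite half_line half_line ..

lemma AE_half_line: "AE t in half_line. t > 0"
  unfolding half_line_def by (subst AE_density) (auto simp: indicator_def)

lemma has_bochner_integral_half_line_iff:
  fixes f :: "real \<Rightarrow> complex"
  assumes [measurable]: "f \<in> borel_measurable borel"
  shows "has_bochner_integral half_line f I \<longleftrightarrow>
    has_bochner_integral lborel (\<lambda>t. indicator {0<..} t *\<^sub>R f t) I"
  unfolding half_line_def has_bochner_integral_iff
  by (simp add: integral_density integrable_density)

lemma has_bochner_integral_half_lineI:
  fixes f :: "real \<Rightarrow> complex"
  assumes [measurable]: "f \<in> borel_measurable borel"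
  assumes "f absolutely_integrable_on {0<..}" "(f has_integral I) {0<..}"
  shows "has_bochner_integral half_line f I"
proof -
  have "set_integrable lborel {0<..} f"
    using assms unfolding set_integrable_def
    by (subst (asm) integrable_completion) auto
  moreover from this have "(LINT x:{0<..}|lborel. f x) = I"
    using assms(3) by (simp add: set_borel_integral_eq_integral integral_unique)
  ultimately show ?thesis unfolding has_bochner_integral_half_line_iff[OF assms(1)]
    by (auto simp: has_bochner_integral_iff set_integrable_def set_lebesgue_integral_def)
qed

lemma has_bochner_integral_half_line_scale:
  fixes f :: "real \<Rightarrow> complex"
  assumes "has_bochner_integral half_line f I" "a > 0"
  shows "has_bochner_integral half_line (\<lambda>t. f (a * t)) (I / of_real a)"
proof -
  have m [measurable]: "f \<in> borel_measurable borel"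
    using assms(1) by (auto simp: has_bochner_integral_iff dest: borel_measurable_integrable)
  have "has_bochner_integral lborel (\<lambda>t. indicator {0<..} (0 + a * t) *\<^sub>R f (0 + a * t)) (I /\<^sub>R \<bar>a\<bar>)"
    using assms by (subst lborel_has_bochner_integral_real_affine_iff[symmetric])
      (auto simp: has_bochner_integral_half_line_iff)
  moreover have "indicator {0<..} (a * t) = (indicator {0<..} t :: real)" for t
    using assms(2) by (auto simp: indicator_def zero_less_mult_iff)
  ultimately show ?thesis using assms(2)
    by (subst has_bochner_integral_half_line_iff) (auto simp: scaleR_conv_of_real field_simps)
qed

lemma Gamma_has_bochner_integral:
  assumes "Re z > 0" "a > 0"
  shows "has_bochner_integral half_line
    (\<lambda>t. of_real t powr (z - 1) * of_real (exp (- (a * t)))) (Gamma z * of_real a powr (- z))"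
proof -
  have "has_bochner_integral half_line (\<lambda>t. of_real t powr (z - 1) / of_real (exp t)) (Gamma z)"
    using absolutely_integrable_Gamma_integral'[OF assms(1)] Gamma_integral_complex'[OF assms(1)]
    by (intro has_bochner_integral_half_lineI) auto
  from has_bochner_integral_half_line_scale[OF this assms(2)]
  have "has_bochner_integral half_line (\<lambda>t. of_real a powr (1 - z) * (of_real (a * t) powr (z - 1) / of_real (exp (a * t))))
     (of_real a powr (1 - z) * (Gamma z / of_real a))"
    by (rule has_bochner_integral_mult_right)
  moreover have "of_real a powr (1 - z) * (Gamma z / of_real a) = Gamma z * of_real a powr (- z)"
    using assms(2) by (simp add: powr_diff powr_minus field_simps)
  moreover have "of_real a powr (1 - z) * (of_real (a * t) powr (z - 1) / of_real (exp (a * t))) =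
      of_real t powr (z - 1) * of_real (exp (- (a * t)))" if "t > 0" for t
  proof -
    have "of_real (a * t) powr (z - 1) = of_real a powr (z - 1) * of_real t powr (z - 1)"
      using assms(2) that by (simp add: powr_times_real)
    moreover have "complex_of_real a powr (1 - z) * of_real a powr (z - 1) = 1"
      using assms(2) by (simp flip: powr_add)
    ultimately show ?thesis
      by (simp add: exp_minus of_real_inverse divide_inverse mult.assoc[symmetric])
  qed
  ultimately show ?thesis
    using AE_half_line
    by (subst has_bochner_integral_cong_AE[where g = "\<lambda>t. of_real a powr (1 - z) * (of_real (a * t) powr (z - 1) / of_real (exp (a * t)))"])
      (auto elim!: AE_mp)
qed

lemma of_real_norm_powr:
  "t \<ge> 0 \<Longrightarrow> complex_of_real (norm (complex_of_real t powr z)) = complex_of_real t powr complex_of_real (Re z)"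
  by (simp add: norm_powr_real_powr powr_of_real)

text \<open>
In the integrals below the norm of an integrand is again an integrand of the same family, with every
exponent replaced by its real part. Hence both the absolute convergence and the value of an
iterated integral follow from one complex-valued computation. The next three lemmas are Tonelli's
and Fubini's theorems in the form that this observation calls for; the first two assume an inner integral \<open>G\<close>
of the norm that is complex-valued for that reason.
\<close>

lemma integrable_pair_of_iterated_norm:
  fixes f :: "'a \<times> 'b \<Rightarrow> complex"
  assumes "pair_sigma_finite M N"
    and [measurable]: "f \<in> borel_measurable (M \<Otimes>\<^sub>M N)"
    and inner: "AE x in M. has_bochner_integral N (\<lambda>y. complex_of_real (norm (f (x, y)))) (G x)"
    and outer: "integrable M G"
  shows "integrable (M \<Otimes>\<^sub>M N) f"
proof -
  interpret pair_sigma_finite M N by fact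
  have inner': "AE x in M. has_bochner_integral N (\<lambda>y. norm (f (x, y))) (Re (G x))"
    using inner by eventually_elim (use has_bochner_integral_bounded_linear[OF bounded_linear_Re] in force)
  show ?thesis
  proof (rule Fubini_integrable)
    show "AE x in M. integrable N (\<lambda>y. f (x, y))"
      using inner' AE_space
    proof eventually_elim
      case (elim x)
      then have "(\<lambda>y. f (x, y)) \<in> borel_measurable N" by simp
      moreover have "integrable N (\<lambda>y. norm (f (x, y)))"
        using elim by (simp add: has_bochner_integral_iff)
      ultimately show ?case by (rule integrable_norm_cancel[rotated])
    qed
    have "AE x in M. Re (G x) = (\<integral>y. norm (f (x, y)) \<partial>N)"
      using inner' by eventually_elim (simp add: has_bochner_integral_iff)
    moreover have G: "integrable M (\<lambda>x. Re (G x))" using outer by simp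
    moreover from G have "(\<lambda>x. Re (G x)) \<in> borel_measurable M" by (rule borel_measurable_integrable)
    ultimately show "integrable M (\<lambda>x. \<integral>y. norm (f (x, y)) \<partial>N)"
      by (subst (asm) integrable_cong_AE) auto
  qed fact
qed

lemma has_bochner_integral_pairI:
  fixes f :: "'a \<times> 'b \<Rightarrow> complex"
  assumes "pair_sigma_finite M N"
    and "f \<in> borel_measurable (M \<Otimes>\<^sub>M N)"
    and "AE x in M. has_bochner_integral N (\<lambda>y. complex_of_real (norm (f (x, y)))) (G x)"
    and "integrable M G"
    and inner: "AE x in M. has_bochner_integral N (\<lambda>y. f (x, y)) (H x)"
    and outer: "has_bochner_integral M H I"
  shows "has_bochner_integral (M \<Otimes>\<^sub>M N) f I"
proof -
  interpret pair_sigma_finite M N by fact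
  have int: "integrable (M \<Otimes>\<^sub>M N) f"
    by (rule integrable_pair_of_iterated_norm) fact+
  have "integral\<^sup>L (M \<Otimes>\<^sub>M N) f = (\<integral>x. \<integral>y. f (x, y) \<partial>N \<partial>M)"
    by (rule integral_fst'[OF int, symmetric])
  also have "\<dots> = (\<integral>x. H x \<partial>M)"
  proof (rule integral_cong_AE)
    show "AE x in M. (\<integral>y. f (x, y) \<partial>N) = H x"
      using inner by eventually_elim (simp add: has_bochner_integral_iff)
  qed (use integrable_fst'[OF int] outer in \<open>auto simp: has_bochner_integral_iff\<close>)
  finally show ?thesis
    using int outer by (simp add: has_bochner_integral_iff)
qed

lemma has_bochner_integral_pair_snd:
  fixes f :: "'a \<times> 'b \<Rightarrow> complex"
  assumes "pair_sigma_finite M N"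
    and f: "has_bochner_integral (M \<Otimes>\<^sub>M N) f I"
    and inner: "AE y in N. has_bochner_integral M (\<lambda>x. f (x, y)) (K y)"
    and K: "K \<in> borel_measurable N"
  shows "has_bochner_integral N K I"
proof -
  interpret pair_sigma_finite M N by fact
  have int: "integrable (M \<Otimes>\<^sub>M N) (case_prod (\<lambda>x y. f (x, y)))"
    using f by (simp add: has_bochner_integral_iff)
  have eq: "AE y in N. (\<integral>x. f (x, y) \<partial>M) = K y"
    using inner by eventually_elim (simp add: has_bochner_integral_iff)
  have "has_bochner_integral N (\<lambda>y. \<integral>x. f (x, y) \<partial>M) I"
    using integrable_snd[OF int] integral_snd[OF int] f by (simp add: has_bochner_integral_iff)
  then show ?thesis
    by (subst (asm) has_bochner_integral_cong_AE[OF _ K eq])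
       (use integrable_snd[OF int] in auto)
qed

section \<open>Integrals of Beta type\<close>

text \<open>
Both sides, multiplied by \<open>\<Gamma>(p + q)\<close>, are the two iterated integrals of
\<open>y powr (q - 1) * s powr (p + q - 1) * exp (- s * (A + y * B))\<close> over the quadrant: each inner
integral is a Gamma integral.
\<close>

lemma feynman_integral:
  assumes "Re p > 0" "Re q > 0" "A > 0" "B > 0"
  shows "has_bochner_integral half_line
    (\<lambda>y. of_real y powr (q - 1) * of_real (A + y * B) powr (- (p + q)))
    (of_real A powr (- p) * of_real B powr (- q) * Beta p q)"
proof -
  define f where "f p q = (\<lambda>(s, y). of_real y powr (q - 1) * of_real s powr (p + q - 1) *
    of_real (exp (- (s * (A + y * B)))) :: complex)" for p q :: complex
  have [measurable]: "f p q \<in> borel_measurable (half_line \<Otimes>\<^sub>M half_line)" for p q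
    unfolding f_def by measurable
  define H where "H p q s = Gamma q * of_real B powr (- q) * (of_real s powr (p - 1) * of_real (exp (- (A * s))))" for p q :: complex and s :: real
  have inner: "AE s in half_line. has_bochner_integral half_line (\<lambda>y. f p q (s, y)) (H p q s)"
    if "Re p > 0" "Re q > 0" for p q
    using AE_half_line
  proof eventually_elim
    case (elim s)
    have "has_bochner_integral half_line
        (\<lambda>y. of_real s powr (p + q - 1) * of_real (exp (- (A * s))) * (of_real y powr (q - 1) * of_real (exp (- ((s * B) * y)))))
        (of_real s powr (p + q - 1) * of_real (exp (- (A * s))) * (Gamma q * of_real (s * B) powr (- q)))"
      using elim assms that
      by (intro has_bochner_integral_mult_right Gamma_has_bochner_integral) auto
    moreover have "of_real s powr (p + q - 1) * of_real (exp (- (A * s))) * (Gamma q * of_real (s * B) powr (- q)) = H p q s"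
    proof -
      have "complex_of_real (s * B) powr (- q) = of_real s powr (- q) * of_real B powr (- q)"
        using elim assms by (simp add: powr_times_real)
      moreover have "complex_of_real s powr (p + q - 1) * of_real s powr (- q) = of_real s powr (p - 1)"
        using elim by (simp flip: powr_add)
      ultimately show ?thesis by (simp add: H_def mult_ac)
    qed
    moreover have "of_real s powr (p + q - 1) * of_real (exp (- (A * s))) * (of_real y powr (q - 1) * of_real (exp (- ((s * B) * y)))) = f p q (s, y)" for y
    proof -
      have "exp (- (s * (A + y * B))) = exp (- (A * s)) * exp (- ((s * B) * y))"
        by (simp flip: exp_add add: algebra_simps)
      then show ?thesis by (simp add: f_def mult_ac)
    qed
    ultimately show ?case by simp
  qed
  have outer: "has_bochner_integral half_line (H p q) (Gamma q * of_real B powr (- q) * (Gamma p * of_real A powr (- p)))"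
    if "Re p > 0" for p q
    unfolding H_def using that assms by (intro has_bochner_integral_mult_right Gamma_has_bochner_integral)
  have "AE s in half_line. has_bochner_integral half_line (\<lambda>y. f (Re p) (Re q) (s, y)) (H (Re p) (Re q) s)"
    using assms by (intro inner) auto
  then have norm_f: "AE s in half_line. has_bochner_integral half_line (\<lambda>y. complex_of_real (norm (f p q (s, y)))) (H (Re p) (Re q) s)"
    using AE_half_line
  proof eventually_elim
    case (elim s)
    have "AE y in half_line. f (Re p) (Re q) (s, y) = complex_of_real (norm (f p q (s, y)))"
      using AE_half_line by eventually_elim (use elim in \<open>simp add: f_def norm_mult of_real_norm_powr\<close>)
    then show ?case
      using elim assms by (subst (asm) has_bochner_integral_cong_AE) auto
  qed
  have "has_bochner_integral (half_line \<Otimes>\<^sub>M half_line) (f p q) (Gamma q * of_real B powr (- q) * (Gamma p * of_real A powr (- p)))"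
    using outer[of "Re p" "Re q"] assms
    by (intro has_bochner_integral_pairI[OF half_line_pair.pair_sigma_finite_axioms _ norm_f _ inner outer])
      (auto simp: has_bochner_integral_iff)
  moreover have "AE y in half_line. has_bochner_integral half_line (\<lambda>s. f p q (s, y))
      (of_real y powr (q - 1) * (Gamma (p + q) * of_real (A + y * B) powr (- (p + q))))"
    using AE_half_line
  proof eventually_elim
    case (elim y)
    have "has_bochner_integral half_line
        (\<lambda>s. of_real y powr (q - 1) * (of_real s powr (p + q - 1) * of_real (exp (- ((A + y * B) * s)))))
      (of_real y powr (q - 1) * (Gamma (p + q) * of_real (A + y * B) powr (- (p + q))))"
      using elim assms
      by (intro has_bochner_integral_mult_right Gamma_has_bochner_integral) (auto intro: add_pos_pos)
    then show ?case by (simp add: f_def mult_ac)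
  qed
  ultimately have "has_bochner_integral half_line
     (\<lambda>y. of_real y powr (q - 1) * (Gamma (p + q) * of_real (A + y * B) powr (- (p + q))))
     (Gamma q * of_real B powr (- q) * (Gamma p * of_real A powr (- p)))"
    by (rule has_bochner_integral_pair_snd[OF half_line_pair.pair_sigma_finite_axioms]) simp
  then have "has_bochner_integral half_line
     (\<lambda>y. inverse (Gamma (p + q)) * (of_real y powr (q - 1) * (Gamma (p + q) * of_real (A + y * B) powr (- (p + q)))))
     (inverse (Gamma (p + q)) * (Gamma q * of_real B powr (- q) * (Gamma p * of_real A powr (- p))))"
    by (rule has_bochner_integral_mult_right)
  moreover have "Gamma (p + q) \<noteq> 0"
    using assms by (auto simp: Gamma_eq_zero_iff elim!: nonpos_Ints_cases dest!: arg_cong[of _ _ Re])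
  ultimately show ?thesis by (simp add: Beta_def field_simps)
qed

text \<open>
The substitution \<open>t = w\<^sup>2\<close> as an identity of measures, so that it applies to complex integrands
without any further discussion of convergence. Both measures give \<open>{..t}\<close> the mass \<open>2 * sqrt t\<close>.
\<close>

lemma distr_square:
  "distr lborel borel (\<lambda>w::real. w\<^sup>2) = density lborel (\<lambda>t. ennreal (indicator {0<..} t * t powr (-1/2)))"
proof -
  have E: "emeasure (distr lborel borel (\<lambda>w::real. w\<^sup>2)) {..t} = ennreal (2 * sqrt (max 0 t))" for t
  proof -
    have "(\<lambda>w::real. w\<^sup>2) -` {..t} = (if t < 0 then {} else {- sqrt t..sqrt t})"
    proof (cases "t < 0")
      case False
      have "w\<^sup>2 \<le> t \<longleftrightarrow> \<bar>w\<bar> \<le> sqrt t" for w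
        using False by (metis abs_ge_zero linorder_not_less power2_abs real_le_rsqrt real_sqrt_le_iff real_sqrt_abs)
      then show ?thesis using False by (auto simp: abs_le_iff)
    next
      case True
      then have "\<not> w\<^sup>2 \<le> t" for w using zero_le_power2[of w] by linarith
      with True show ?thesis by auto
    qed
    then show ?thesis by (simp add: emeasure_distr)
  qed
  show ?thesis
  proof (rule measure_eqI_generator_eq[where E = "range atMost" and \<Omega> = UNIV and A = "\<lambda>n. {..real n}"])
  fix X assume "X \<in> range (atMost :: real \<Rightarrow> _)"
  then obtain t where X: "X = {..t}" by auto
  have "emeasure (density lborel (\<lambda>t. ennreal (indicator {0<..} t * t powr (-1/2)))) {..t} =
      (\<integral>\<^sup>+x. ennreal (indicator {0<..} x * x powr (-1/2)) * indicator {..t} x \<partial>lborel)"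
    by (subst emeasure_density) auto
  also have "\<dots> = (\<integral>\<^sup>+x. ennreal (x powr (-1/2)) * indicator {0..max 0 t} x \<partial>lborel)"
    by (intro nn_integral_cong) (auto simp: indicator_def)
  also have "\<dots> = ennreal (max 0 t powr (-1/2+1) / (-1/2+1))"
    by (intro nn_integral_has_integral_lebesgue' has_integral_powr_from_0) auto
  also have "max 0 t powr (-1/2+1) / (-1/2+1) = 2 * sqrt (max 0 t)"
    by (simp add: powr_half_sqrt)
  finally show "emeasure (distr lborel borel (\<lambda>w::real. w\<^sup>2)) X =
      emeasure (density lborel (\<lambda>t. ennreal (indicator {0<..} t * t powr (-1/2)))) X"
    using E X by simp
next
  show "emeasure (distr lborel borel (\<lambda>w::real. w\<^sup>2)) {..real n} \<noteq> \<infinity>" for n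
    by (simp only: E) simp
  qed (auto simp: Int_stable_def borel_eq_atMost intro: real_arch_simple)
qed



lemma of_real_square_powr:
  "complex_of_real (w\<^sup>2) powr (c / 2) = complex_of_real \<bar>w\<bar> powr c"
proof (cases "w = 0")
  case False
  then have "ln (w\<^sup>2) = 2 * ln \<bar>w\<bar>"
    by (metis ln_realpow power2_abs zero_less_abs_iff of_nat_numeral)
  moreover have "Ln (complex_of_real (w\<^sup>2)) = of_real (ln (w\<^sup>2))" "Ln (complex_of_real \<bar>w\<bar>) = of_real (ln \<bar>w\<bar>)"
    using False by (intro Ln_of_real; simp)+
  ultimately show ?thesis
    using False by (simp add: powr_def del: of_real_power)
qed auto

text \<open>
Substituting \<open>t = w\<^sup>2\<close> leads to Feynman's integral with exponents \<open>n - (c + 1) / 2\<close> and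
\<open>(c + 1) / 2\<close>.
\<close>

lemma abs_powr_quadratic_integral:
  assumes "Re c > - 1" "Re n > (Re c + 1) / 2" "A > 0" "B > 0"
  shows "has_bochner_integral lborel
    (\<lambda>w. of_real \<bar>w\<bar> powr c * of_real (A + w\<^sup>2 * B) powr (- n))
    (of_real A powr ((c + 1) / 2 - n) * of_real B powr (- ((c + 1) / 2)) * Beta (n - (c + 1) / 2) ((c + 1) / 2))"
    (is "has_bochner_integral _ _ ?I")
proof -
  define f where "f t = complex_of_real t powr (c / 2) * of_real (A + t * B) powr (- n)" for t
  have [measurable]: "f \<in> borel_measurable borel" unfolding f_def by measurable
  have "has_bochner_integral half_line
      (\<lambda>t. of_real t powr ((c + 1) / 2 - 1) * of_real (A + t * B) powr (- (n - (c + 1) / 2 + (c + 1) / 2)))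
      (of_real A powr (- (n - (c + 1) / 2)) * of_real B powr (- ((c + 1) / 2)) * Beta (n - (c + 1) / 2) ((c + 1) / 2))"
    using assms by (intro feynman_integral) auto
  then have "has_bochner_integral lborel
      (\<lambda>t. indicator {0<..} t *\<^sub>R (of_real t powr ((c + 1) / 2 - 1) * of_real (A + t * B) powr (- n))) ?I"
    by (subst (asm) has_bochner_integral_half_line_iff) auto
  moreover have eq: "indicator {0<..} t *\<^sub>R (of_real t powr ((c + 1) / 2 - 1) * of_real (A + t * B) powr (- n)) =
      (indicator {0<..} t * t powr (-1/2)) *\<^sub>R f t" for t
  proof (cases "t > 0")
    case True
    have "complex_of_real t powr ((c + 1) / 2 - 1) = of_real (t powr (-1/2)) * of_real t powr (c / 2)"
      using True powr_of_real[of t "-1/2", symmetric] by (simp flip: powr_add add: field_simps)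
    then show ?thesis by (simp add: f_def scaleR_conv_of_real)
  qed auto
  ultimately have "has_bochner_integral lborel (\<lambda>t. (indicator {0<..} t * t powr (-1/2)) *\<^sub>R f t) ?I"
    unfolding eq by blast
  then have "has_bochner_integral (density lborel (\<lambda>t. ennreal (indicator {0<..} t * t powr (-1/2)))) f ?I"
    by (intro has_bochner_integral_density) auto
  then have "has_bochner_integral lborel (\<lambda>w. f (w\<^sup>2)) ?I"
    unfolding distr_square[symmetric] has_bochner_integral_iff
    by (simp add: integrable_distr_eq integral_distr)
  then show ?thesis unfolding f_def of_real_square_powr .
qed

lemma has_bochner_integral_translate:
  fixes f :: "real \<Rightarrow> complex"
  assumes "has_bochner_integral lborel f I"
  shows "has_bochner_integral lborel (\<lambda>x. f (x + s)) I"
  using lborel_has_bochner_integral_real_affine_iff[of 1 f I s] assms by (simp add: add.commute)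

lemma quadratic_integral:
  assumes "Re n > 1 / 2" "A > 0" "B > 0"
  shows "has_bochner_integral lborel (\<lambda>w. of_real (A + (w + s)\<^sup>2 * B) powr (- n))
    (of_real A powr (1 / 2 - n) * of_real B powr (- (1 / 2)) * Beta (n - 1 / 2) (1 / 2))"
    (is "has_bochner_integral _ _ ?I")
proof -
  have m1: "(\<lambda>w. of_real \<bar>w\<bar> powr 0 * complex_of_real (A + w\<^sup>2 * B) powr (- n)) \<in> borel_measurable lborel"
    by measurable
  have m2: "(\<lambda>w. complex_of_real (A + w\<^sup>2 * B) powr (- n)) \<in> borel_measurable lborel"
    by measurable
  have half: "(0 + 1) / 2 = (1 / 2 :: complex)" by simp
  have "has_bochner_integral lborel (\<lambda>w. of_real \<bar>w\<bar> powr 0 * of_real (A + w\<^sup>2 * B) powr (- n)) ?I"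
  proof -
    have "Re 0 > - 1" "Re n > (Re 0 + 1) / 2" using assms(1) by simp_all
    from abs_powr_quadratic_integral[OF this assms(2,3), unfolded half] show ?thesis .
  qed
  moreover have "AE w in lborel. w \<noteq> (0::real)" by (rule AE_lborel_singleton)
  then have "AE w in lborel. of_real \<bar>w\<bar> powr 0 * of_real (A + w\<^sup>2 * B) powr (- n) = complex_of_real (A + w\<^sup>2 * B) powr (- n)"
    by eventually_elim simp
  ultimately have "has_bochner_integral lborel (\<lambda>w. complex_of_real (A + w\<^sup>2 * B) powr (- n)) ?I"
    by (rule has_bochner_integral_cong_AE[THEN iffD1, OF m1 m2, rotated])
  from has_bochner_integral_translate[OF this, of s] show ?thesis .
qed

section \<open>The kernel on the plane\<close>

lemma of_real_divide_powr:
  assumes "a \<ge> 0" "b > 0"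
  shows "complex_of_real (a / b) powr s = of_real a powr s * of_real b powr (- s)"
proof -
  have "complex_of_real (a / b * b) powr s = of_real (a / b) powr s * of_real b powr s"
    unfolding of_real_mult using assms by (intro powr_times_real) auto
  then show ?thesis using assms by (simp add: powr_minus divide_simps)
qed

text \<open>
For fixed \<open>y\<close>, completing the square in \<open>v\<close> gives
\<open>(1 + v\<^sup>2) + y * (1 + (v + w)\<^sup>2) = m w + (v + y * w / (1 + y))\<^sup>2 * (1 + y)\<close> with
\<open>m w = (1 + y) + w\<^sup>2 * (y / (1 + y))\<close>. The inner integral over \<open>v\<close> is therefore a multiple of
\<open>m w powr (1 / 2 - n)\<close>, and the outer one over \<open>w\<close> is of the same quadratic type.
\<close>

lemma plane_integral:
  assumes "Re c > - 1" "Re n > 1 / 2" "Re n > 1 + Re c / 2" "y > 0"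
  defines "f \<equiv> \<lambda>c n (w, v). of_real \<bar>w\<bar> powr c * complex_of_real ((1 + v\<^sup>2) + y * (1 + (v + w)\<^sup>2)) powr (- n)"
  shows "has_bochner_integral (lborel \<Otimes>\<^sub>M lborel) (f c n)
    (Beta (n - 1 / 2) (1 / 2) * Beta (n - c / 2 - 1) ((c + 1) / 2) *
     (of_real y powr (- ((c + 1) / 2)) * of_real (1 + y) powr (c + 1 - n)))"
    (is "has_bochner_integral _ _ ?I")
proof -
  define m where "m w = (1 + y) + w\<^sup>2 * (y / (1 + y))" for w
  have m: "m w > 0" for w using assms(4) unfolding m_def by (intro add_pos_nonneg) auto
  have "(1 + v\<^sup>2) + y * (1 + (v + w)\<^sup>2) = m w + (v + y * w / (1 + y))\<^sup>2 * (1 + y)" for v w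
  proof -
    define b where "b = y / (1 + y)"
    have b: "b * (1 + y) = y" using assms(4) by (simp add: b_def)
    have "(v + b * w)\<^sup>2 * (1 + y) = v\<^sup>2 * (1 + y) + 2 * v * w * (b * (1 + y)) + b * w\<^sup>2 * (b * (1 + y))"
      by (simp add: power2_eq_square algebra_simps)
    also have "\<dots> = v\<^sup>2 * (1 + y) + 2 * v * w * y + b * w\<^sup>2 * y"
      unfolding b by simp
    also have "b * w\<^sup>2 * y = w\<^sup>2 * (b * (1 + y)) - b * w\<^sup>2"
      by (simp add: algebra_simps)
    also have "v\<^sup>2 * (1 + y) + 2 * v * w * y + \<dots> = (1 + v\<^sup>2) + y * (1 + (v + w)\<^sup>2) - ((1 + y) + w\<^sup>2 * b)"
      unfolding b by (simp add: power2_eq_square algebra_simps)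
    finally show ?thesis by (simp add: m_def b_def)
  qed
  then have f_eq: "f c n (w, v) = of_real \<bar>w\<bar> powr c * complex_of_real (m w + (v + y * w / (1 + y))\<^sup>2 * (1 + y)) powr (- n)" for c n w v
    by (simp add: f_def)
  have [measurable]: "f c n \<in> borel_measurable (lborel \<Otimes>\<^sub>M lborel)" for c n
    unfolding f_def by measurable
  define H where "H c n w = of_real (1 + y) powr (- (1 / 2)) * Beta (n - 1 / 2) (1 / 2) *
     (of_real \<bar>w\<bar> powr c * of_real (m w) powr (- (n - 1 / 2)))" for c n :: complex and w
  have inner: "has_bochner_integral lborel (\<lambda>v. f c n (w, v)) (H c n w)" if "Re n > 1 / 2" for c n w
  proof -
    have "has_bochner_integral lborel (\<lambda>v. f c n (w, v)) (of_real \<bar>w\<bar> powr c *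
      (of_real (m w) powr (1 / 2 - n) * of_real (1 + y) powr (- (1 / 2)) * Beta (n - 1 / 2) (1 / 2)))"
      unfolding f_eq using that m assms(4) by (intro has_bochner_integral_mult_right quadratic_integral) auto
    then show ?thesis by (simp add: H_def mult_ac)
  qed
  have outer: "has_bochner_integral lborel (H c n)
      (of_real (1 + y) powr (- (1 / 2)) * Beta (n - 1 / 2) (1 / 2) *
        (of_real (1 + y) powr ((c + 1) / 2 - (n - 1 / 2)) * of_real (y / (1 + y)) powr (- ((c + 1) / 2)) *
         Beta (n - 1 / 2 - (c + 1) / 2) ((c + 1) / 2)))"
    if "Re c > - 1" "Re n > 1 + Re c / 2" for c n
    unfolding H_def m_def using that assms(4)
    by (intro has_bochner_integral_mult_right abs_powr_quadratic_integral) auto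
  have norm_f: "has_bochner_integral lborel (\<lambda>v. complex_of_real (norm (f c n (w, v)))) (H (Re c) (Re n) w)" for w
  proof -
    have "complex_of_real (norm (f c n (w, v))) = f (Re c) (Re n) (w, v)" for v
    proof -
      have "m w + (v + y * w / (1 + y))\<^sup>2 * (1 + y) \<ge> 0"
        using m[of w] assms(4) by (intro add_nonneg_nonneg mult_nonneg_nonneg) auto
      then show ?thesis unfolding f_eq by (simp only: norm_mult of_real_mult of_real_norm_powr abs_ge_zero uminus_complex.sel) simp
    qed
    then show ?thesis using inner[of "Re n" "Re c" w] assms(2) by simp
  qed
  have int: "has_bochner_integral (lborel \<Otimes>\<^sub>M lborel) (f c n) (of_real (1 + y) powr (- (1 / 2)) * Beta (n - 1 / 2) (1 / 2) *
        (of_real (1 + y) powr ((c + 1) / 2 - (n - 1 / 2)) * of_real (y / (1 + y)) powr (- ((c + 1) / 2)) *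
         Beta (n - 1 / 2 - (c + 1) / 2) ((c + 1) / 2)))"
  proof (rule has_bochner_integral_pairI[OF lborel_pair.pair_sigma_finite_axioms])
    show "integrable lborel (H (Re c) (Re n))"
      using outer[of "Re c" "Re n"] assms(1-4) by (auto simp: has_bochner_integral_iff)
    show "f c n \<in> borel_measurable (lborel \<Otimes>\<^sub>M lborel)" by measurable
    show "AE w in lborel. has_bochner_integral lborel (\<lambda>v. complex_of_real (norm (f c n (w, v)))) (H (Re c) (Re n) w)"
      by (intro AE_I2 norm_f)
    show "AE w in lborel. has_bochner_integral lborel (\<lambda>v. f c n (w, v)) (H c n w)"
      by (intro AE_I2 inner assms(2))
  qed (rule outer[OF assms(1,3)])
  have eq: "of_real (1 + y) powr (- (1 / 2)) * (of_real (1 + y) powr ((c + 1) / 2 - (n - 1 / 2)) * of_real (y / (1 + y)) powr (- ((c + 1) / 2)))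
     = of_real y powr (- ((c + 1) / 2)) * of_real (1 + y) powr (c + 1 - n)"
  proof -
    have "of_real (y / (1 + y)) powr (- ((c + 1) / 2)) = of_real y powr (- ((c + 1) / 2)) * complex_of_real (1 + y) powr ((c + 1) / 2)"
      using of_real_divide_powr[of y "1 + y" "- ((c + 1) / 2)"] assms(4) by (simp only: minus_minus)
    moreover have "complex_of_real (1 + y) powr (- (1 / 2)) * (of_real (1 + y) powr ((c + 1) / 2 - (n - 1 / 2)) * of_real (1 + y) powr ((c + 1) / 2)) = of_real (1 + y) powr (c + 1 - n)"
    proof -
      have "- (1 / 2) + ((c + 1) / 2 - (n - 1 / 2) + (c + 1) / 2) = c + 1 - n"
        by (simp add: add_divide_distrib)
      then show ?thesis by (simp only: powr_add[symmetric])
    qed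
    ultimately show ?thesis by (simp add: mult_ac)
  qed
  have "X * b1 * (Y * Z * b2) = b1 * b2 * (X * (Y * Z))" for X Y Z b1 b2 :: complex
    by (simp only: mult_ac)
  note arrange = this
  have "n - 1 / 2 - (c + 1) / 2 = n - c / 2 - 1" by (simp add: add_divide_distrib)
  with int show ?thesis by (simp only: arrange eq)
qed



text \<open>
The variable \<open>w\<close> stands for the difference \<open>u - v\<close>. The product of the two powers is replaced by
Feynman's integral over \<open>y\<close>, and \<open>y\<close> is then integrated last. By \<open>plane_integral\<close> what remains
in \<open>y\<close> is once more Feynman's integral, now with \<open>A = B = 1\<close> and the exponents \<open>P\<close> and \<open>Q\<close>.
\<close>

lemma kernel_plane_integral:
  assumes c: "Re c > - 1" and p: "Re p > (Re c + 1) / 2" and q: "Re q > (Re c + 1) / 2"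
    and n: "Re (p + q) > 1 + Re c / 2"
  defines "P \<equiv> p - (c + 1) / 2" and "Q \<equiv> q - (c + 1) / 2"
  shows "has_bochner_integral (lborel \<Otimes>\<^sub>M lborel)
    (\<lambda>(w, v). of_real \<bar>w\<bar> powr c * (of_real (1 + v\<^sup>2) powr (- p) * of_real (1 + (v + w)\<^sup>2) powr (- q)))
    (Beta (p + q - 1 / 2) (1 / 2) * Beta (p + q - c / 2 - 1) ((c + 1) / 2) * Beta P Q / Beta p q)"
    (is "has_bochner_integral _ (\<lambda>(w, v). ?K w v) _")
proof -
  let ?plane = "lborel \<Otimes>\<^sub>M lborel :: (real \<times> real) measure"
  have pair: "pair_sigma_finite half_line ?plane" ..
  define g where "g c n y wv = (case wv of (w, v) \<Rightarrow>
      of_real \<bar>w\<bar> powr c * complex_of_real ((1 + v\<^sup>2) + y * (1 + (v + w)\<^sup>2)) powr (- n))" for c n :: complex and y :: real and wv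
  define f where "f c n q = (\<lambda>(y, wv). of_real y powr (q - 1) * g c n y wv)" for c n q :: complex
  have [measurable]: "f c n q \<in> borel_measurable (half_line \<Otimes>\<^sub>M ?plane)" for c n q
    unfolding f_def g_def by measurable
  define C where "C c n = Beta (n - 1 / 2) (1 / 2) * Beta (n - c / 2 - 1) ((c + 1) / 2)" for c n :: complex
  define H where "H c n q y = of_real y powr (q - 1) *
    (C c n * (of_real y powr (- ((c + 1) / 2)) * of_real (1 + y) powr (c + 1 - n)))" for c n q :: complex and y :: real
  have n2: "Re (p + q) > 1 / 2" using n c by simp
  have inner: "has_bochner_integral ?plane (\<lambda>wv. f c n q (y, wv)) (H c n q y)"
    if "Re c > - 1" "Re n > 1 / 2" "Re n > 1 + Re c / 2" "y > 0" for c n q y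
    unfolding f_def H_def C_def g_def split_beta fst_conv snd_conv
    using plane_integral[OF that] by (intro has_bochner_integral_mult_right) (simp add: split_beta')
  have outer: "has_bochner_integral half_line (H c (p + q) q) (C c (p + q) * Beta (p - (c + 1) / 2) (q - (c + 1) / 2))"
    if "Re p > (Re c + 1) / 2" "Re q > (Re c + 1) / 2" for c p q
  proof -
    have 1: "Re (p - (c + 1) / 2) > 0" "Re (q - (c + 1) / 2) > 0" using that by auto
    have "has_bochner_integral half_line (\<lambda>y. C c (p + q) *
        (of_real y powr (q - (c + 1) / 2 - 1) * of_real (1 + y * 1) powr (- (p - (c + 1) / 2 + (q - (c + 1) / 2)))))
      (C c (p + q) * (of_real 1 powr (- (p - (c + 1) / 2)) * of_real 1 powr (- (q - (c + 1) / 2)) * Beta (p - (c + 1) / 2) (q - (c + 1) / 2)))"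
      by (intro has_bochner_integral_mult_right feynman_integral 1) auto
    moreover have "C c (p + q) *
        (of_real y powr (q - (c + 1) / 2 - 1) * of_real (1 + y * 1) powr (- (p - (c + 1) / 2 + (q - (c + 1) / 2)))) = H c (p + q) q y" for y
    proof -
      have "q - (c + 1) / 2 - 1 = (q - 1) + - ((c + 1) / 2)" by simp
      moreover have "- (p - (c + 1) / 2 + (q - (c + 1) / 2)) = c + 1 - (p + q)"
        by (simp add: add_divide_distrib)
      ultimately show ?thesis by (simp only: H_def powr_add mult_1_left mult_1_right mult_ac)
    qed
    ultimately show ?thesis by (simp only:) simp
  qed
  (* The norm of the integrand belongs to the same family, so inner and outer apply to it. *)
  have norm_f: "complex_of_real (norm (f c n q (y, wv))) = f (Re c) (Re n) (Re q) (y, wv)" if "y > 0" for c n q y wv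
  proof -
    obtain w v where wv: "wv = (w, v)" by (cases wv)
    have "(1 + v\<^sup>2) + y * (1 + (v + w)\<^sup>2) \<ge> 0"
      using that by (intro add_nonneg_nonneg mult_nonneg_nonneg) auto
    with that show ?thesis
      unfolding f_def g_def wv split_beta fst_conv snd_conv
      by (simp only: norm_mult of_real_mult of_real_norm_powr abs_ge_zero less_imp_le) simp
  qed
  have "has_bochner_integral (half_line \<Otimes>\<^sub>M ?plane) (f c (p + q) q) (C c (p + q) * Beta P Q)"
  proof (rule has_bochner_integral_pairI[OF pair])
    show "AE y in half_line. has_bochner_integral ?plane (\<lambda>wv. complex_of_real (norm (f c (p + q) q (y, wv)))) (H (Re c) (Re p + Re q) (Re q) y)"
      using AE_half_line
    proof eventually_elim
      case (elim y)
      have "has_bochner_integral ?plane (\<lambda>wv. f (Re c) (Re (p + q)) (Re q) (y, wv)) (H (Re c) (Re (p + q)) (Re q) y)"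
        by (rule inner) (use c n n2 elim in auto)
      then show ?case unfolding norm_f[OF elim] by simp
    qed
    show "AE y in half_line. has_bochner_integral ?plane (\<lambda>wv. f c (p + q) q (y, wv)) (H c (p + q) q y)"
      using AE_half_line by eventually_elim (rule inner[OF c n2 n])
    show "integrable half_line (H (Re c) (Re p + Re q) (Re q))"
      using outer[of "Re c" "Re p" "Re q"] p q by (auto simp: has_bochner_integral_iff)
    show "has_bochner_integral half_line (H c (p + q) q) (C c (p + q) * Beta P Q)"
      unfolding P_def Q_def by (rule outer[OF p q])
  qed measurable
  moreover have "AE wv in ?plane. has_bochner_integral half_line (\<lambda>y. f c (p + q) q (y, wv)) (Beta p q * (case wv of (w, v) \<Rightarrow> ?K w v))"
  proof (intro AE_I2)
    fix wv :: "real \<times> real"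
    obtain w v where wv: "wv = (w, v)" by (cases wv)
    have pos: "1 + v\<^sup>2 > 0" "1 + (v + w)\<^sup>2 > 0" by (auto intro: add_pos_nonneg)
    have pq: "Re p > 0" "Re q > 0" using p q c by auto
    have "has_bochner_integral half_line (\<lambda>y. of_real \<bar>w\<bar> powr c *
        (of_real y powr (q - 1) * of_real ((1 + v\<^sup>2) + y * (1 + (v + w)\<^sup>2)) powr (- (p + q))))
       (of_real \<bar>w\<bar> powr c * (of_real (1 + v\<^sup>2) powr (- p) * of_real (1 + (v + w)\<^sup>2) powr (- q) * Beta p q))"
      by (intro has_bochner_integral_mult_right feynman_integral pos pq)
    then show "has_bochner_integral half_line (\<lambda>y. f c (p + q) q (y, wv)) (Beta p q * (case wv of (w, v) \<Rightarrow> ?K w v))"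
      unfolding wv f_def g_def split_beta fst_conv snd_conv by (simp only: mult_ac)
  qed
  ultimately have "has_bochner_integral ?plane (\<lambda>wv. Beta p q * (case wv of (w, v) \<Rightarrow> ?K w v)) (C c (p + q) * Beta P Q)"
    by (rule has_bochner_integral_pair_snd[OF pair]) measurable
  then have "has_bochner_integral ?plane (\<lambda>wv. inverse (Beta p q) * (Beta p q * (case wv of (w, v) \<Rightarrow> ?K w v))) (inverse (Beta p q) * (C c (p + q) * Beta P Q))"
    by (rule has_bochner_integral_mult_right)
  moreover have "Beta p q \<noteq> 0"
    using p q c by (auto simp: Beta_def Gamma_eq_zero_iff elim!: nonpos_Ints_cases dest!: arg_cong[of _ _ Re])
  ultimately show ?thesis by (simp add: C_def field_simps)
qed

lemma kernel_iterated_integral: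
  assumes c: "Re c > - 1" and p: "Re p > (Re c + 1) / 2" and q: "Re q > (Re c + 1) / 2"
    and n: "Re (p + q) > 1 + Re c / 2"
  shows "(LINT v|lborel. LINT u|lborel. of_real (1 + v\<^sup>2) powr (- p) * of_real (1 + u\<^sup>2) powr (- q) * of_real \<bar>u - v\<bar> powr c) =
    Beta (p + q - 1 / 2) (1 / 2) * Beta (p + q - c / 2 - 1) ((c + 1) / 2) * Beta (p - (c + 1) / 2) (q - (c + 1) / 2) / Beta p q"
    (is "_ = ?I")
proof -
  define K where "K w v = of_real \<bar>w\<bar> powr c * (of_real (1 + v\<^sup>2) powr (- p) * of_real (1 + (v + w)\<^sup>2) powr (- q))" for w v :: real
  have K: "has_bochner_integral (lborel \<Otimes>\<^sub>M lborel) (\<lambda>(w, v). K w v) ?I"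
    unfolding K_def by (rule kernel_plane_integral[OF assms])
  have "(LINT v|lborel. LINT w|lborel. K w v) = ?I"
    using lborel_pair.integral_snd[of K] K by (simp add: has_bochner_integral_iff)
  moreover have "(LINT w|lborel. K w v) = (LINT u|lborel. of_real (1 + v\<^sup>2) powr (- p) * of_real (1 + u\<^sup>2) powr (- q) * of_real \<bar>u - v\<bar> powr c)" for v
  proof -
    have "(LINT w|lborel. K w v) = (LINT u|lborel. K (- v + 1 * u) v)"
      by (subst lborel_integral_real_affine[of 1 _ "- v"]) simp_all
    then show ?thesis by (simp add: K_def mult_ac)
  qed
  ultimately show ?thesis by simp
qed

section \<open>From the circle to the line\<close>

lemma borel_measurable_tan [measurable]: "tan \<in> borel_measurable (borel :: real measure)"
  unfolding tan_def[abs_def] by measurable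

text \<open>
The image of Lebesgue measure on \<open>(- \<pi> / 2, \<pi> / 2)\<close> under \<open>tan\<close> is the Cauchy distribution, up to
normalisation: both give \<open>{t<..}\<close> the mass \<open>\<pi> / 2 - arctan t\<close>.
\<close>

lemma nn_integral_tan:
  assumes [measurable]: "g \<in> borel_measurable borel"
  shows "(\<integral>\<^sup>+x. g (tan x) * indicator {-pi/2<..<pi/2} x \<partial>lborel) = (\<integral>\<^sup>+u. ennreal (1 / (1 + u\<^sup>2)) * g u \<partial>lborel)"
proof -
  define M where "M = density lborel (\<lambda>x::real. indicator {-pi/2<..<pi/2} x :: ennreal)"
  define N where "N = density lborel (\<lambda>u::real. ennreal (1 / (1 + u\<^sup>2)))"
  have N: "emeasure N {t<..} = ennreal (pi / 2 - arctan t)" for t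
  proof -
    have "emeasure N {t<..} = (\<integral>\<^sup>+u. ennreal (1 / (1 + u\<^sup>2)) * indicator {t<..} u \<partial>lborel)"
      unfolding N_def by (subst emeasure_density) auto
    also have "\<dots> = (\<integral>\<^sup>+u. ennreal (1 / (1 + u\<^sup>2)) * indicator {t..} u \<partial>lborel)"
      by (intro nn_integral_cong_AE eventually_mono[OF AE_lborel_singleton[of t]]) (auto simp: indicator_def)
    also have "\<dots> = ennreal (pi / 2 - arctan t)"
      by (intro nn_integral_FTC_atLeast tendsto_arctan_at_top)
         (auto intro!: derivative_eq_intros simp: add_nonneg_eq_0_iff inverse_eq_divide)
    finally show ?thesis .
  qed
  have MN: "distr M borel tan = N"
  proof (rule measure_eqI_lessThan)
    fix t
    show "emeasure (distr M borel tan) {t<..} < \<infinity>" "emeasure (distr M borel tan) {t<..} = emeasure N {t<..}"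
    proof -
      have "emeasure (distr M borel tan) {t<..} = emeasure M (tan -` {t<..})"
        by (subst emeasure_distr) (auto simp: M_def)
      also have "\<dots> = (\<integral>\<^sup>+x. indicator {-pi/2<..<pi/2} x * indicator (tan -` {t<..}) x \<partial>lborel)"
        unfolding M_def using measurable_sets_borel[OF borel_measurable_tan, of "{t<..}"]
        by (subst emeasure_density) auto
      also have "\<dots> = (\<integral>\<^sup>+x. indicator {arctan t<..<pi/2} x \<partial>lborel)"
      proof (intro nn_integral_cong)
        fix x
        have "t < tan x \<longleftrightarrow> arctan t < x" if "-pi/2 < x" "x < pi/2"
          using that by (metis arctan_less_iff arctan_tan minus_divide_left)
        then show "indicator {-pi/2<..<pi/2} x * indicator (tan -` {t<..}) x = (indicator {arctan t<..<pi/2} x :: ennreal)"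
          using arctan_lbound[of t] by (auto simp: indicator_def)
      qed
      also have "\<dots> = ennreal (pi / 2 - arctan t)"
        using arctan_ubound[of t] by simp
      finally show "emeasure (distr M borel tan) {t<..} < \<infinity>" "emeasure (distr M borel tan) {t<..} = emeasure N {t<..}"
        by (simp_all add: N)
    qed
  qed (simp_all add: N_def)
  have "(\<integral>\<^sup>+x. g (tan x) * indicator {-pi/2<..<pi/2} x \<partial>lborel) = (\<integral>\<^sup>+x. g (tan x) \<partial>M)"
    unfolding M_def by (subst nn_integral_density) (auto simp: mult.commute)
  also have "\<dots> = (\<integral>\<^sup>+u. g u \<partial>distr M borel tan)"
    by (subst nn_integral_distr) (auto simp: M_def)
  also have "\<dots> = (\<integral>\<^sup>+u. ennreal (1 / (1 + u\<^sup>2)) * g u \<partial>lborel)"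
    unfolding MN N_def by (subst nn_integral_density) auto
  finally show ?thesis .
qed

text \<open>
The integral over a window of one period does not depend on where the window starts.
\<close>

lemma nn_integral_periodic:
  fixes h :: "real \<Rightarrow> ennreal"
  assumes [measurable]: "h \<in> borel_measurable borel"
    and per: "\<And>x. h (x + p) = h x" and s: "0 \<le> s" "s \<le> 2 * p"
  shows "(\<integral>\<^sup>+x. h x * indicator {0..2 * p} x \<partial>lborel) = 2 * (\<integral>\<^sup>+x. h x * indicator {s<..<s + p} x \<partial>lborel)"
proof -
  define I where "I a b = (\<integral>\<^sup>+x. h x * indicator {a..<b} x \<partial>lborel)" for a b
  have split: "I a c = I a b + I b c" if "a \<le> b" "b \<le> c" for a b c
    unfolding I_def using that
    by (subst nn_integral_add[symmetric]) (auto intro!: nn_integral_cong simp: indicator_def)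
  have shift: "I (a + p) (b + p) = I a b" for a b
  proof -
    have "I (a + p) (b + p) = (\<integral>\<^sup>+x. h (p + 1 * x) * indicator {a + p..<b + p} (p + 1 * x) \<partial>lborel)"
      unfolding I_def by (subst nn_integral_real_affine[of _ 1 p]) auto
    also have "\<dots> = I a b" unfolding I_def
      by (intro nn_integral_cong) (auto simp: indicator_def add.commute per)
    finally show ?thesis .
  qed
  have one: "I t (t + p) = I 0 p" if "0 \<le> t" "t \<le> p" for t
    using split[of t p "t + p"] split[of 0 t p] shift[of 0 t] that by (simp add: add.commute)
  have "I s (s + p) = I 0 p"
  proof (cases "s \<le> p")
    case False
    then show ?thesis using one[of "s - p"] shift[of "s - p" s] s by simp
  qed (use one s in auto)
  moreover have "I 0 (2 * p) = I 0 p + I 0 p"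
    using split[of 0 p "2 * p"] shift[of 0 p] s by simp
  moreover have "(\<integral>\<^sup>+x. h x * indicator {0..2 * p} x \<partial>lborel) = I 0 (2 * p)"
    unfolding I_def by (intro nn_integral_cong_AE eventually_mono[OF AE_lborel_singleton[of "2 * p"]]) (auto simp: indicator_def)
  moreover have "(\<integral>\<^sup>+x. h x * indicator {s<..<s + p} x \<partial>lborel) = I s (s + p)"
    unfolding I_def by (intro nn_integral_cong_AE eventually_mono[OF AE_lborel_singleton[of s]]) (auto simp: indicator_def)
  ultimately show ?thesis by (simp only: mult_2)
qed

lemma distr_tan_circle:
  assumes s: "0 \<le> s" "s \<le> 2 * pi"
  shows "distr (density lborel (\<lambda>x. ennreal (indicator {0..2 * pi} x))) borel (\<lambda>x. tan (x - s - pi / 2)) =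
    density lborel (\<lambda>u. ennreal (2 / (1 + u\<^sup>2)))" (is "distr ?M _ ?T = ?N")
proof (rule measure_eqI)
  fix A assume "A \<in> sets (distr ?M borel ?T)"
  then have [measurable]: "A \<in> sets borel" by simp
  define h where "h x = (indicator A (?T x) :: ennreal)" for x
  have [measurable]: "h \<in> borel_measurable borel" unfolding h_def by measurable
  have per: "h (x + pi) = h x" for x
    using tan_periodic_pi[of "x - s - pi / 2"] by (simp add: h_def algebra_simps)
  have "emeasure (distr ?M borel ?T) A = (\<integral>\<^sup>+x. indicator A x \<partial>distr ?M borel ?T)" by simp
  also have "\<dots> = (\<integral>\<^sup>+x. h x \<partial>?M)"
    unfolding h_def by (subst nn_integral_distr) auto
  also have "\<dots> = (\<integral>\<^sup>+x. h x * indicator {0..2 * pi} x \<partial>lborel)"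
    by (subst nn_integral_density) (auto intro!: nn_integral_cong simp: indicator_def)
  also have "\<dots> = 2 * (\<integral>\<^sup>+x. h x * indicator {s<..<s + pi} x \<partial>lborel)"
    using s per by (intro nn_integral_periodic) auto
  also have "(\<integral>\<^sup>+x. h x * indicator {s<..<s + pi} x \<partial>lborel) =
      (\<integral>\<^sup>+x. indicator A (tan x) * indicator {-pi/2<..<pi/2} x \<partial>lborel)"
    by (subst nn_integral_real_affine[of _ 1 "s + pi / 2"])
       (auto intro!: nn_integral_cong simp: h_def indicator_def)
  also have "\<dots> = (\<integral>\<^sup>+u. ennreal (1 / (1 + u\<^sup>2)) * indicator A u \<partial>lborel)"
    by (rule nn_integral_tan) auto
  also have "2 * \<dots> = (\<integral>\<^sup>+u. ennreal (2 / (1 + u\<^sup>2)) * indicator A u \<partial>lborel)"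
    by (subst nn_integral_cmult[symmetric]) (auto intro!: nn_integral_cong simp: mult.assoc[symmetric] ennreal_mult[symmetric] simp flip: ennreal_numeral)
  also have "\<dots> = emeasure ?N A"
    by (subst emeasure_density) auto
  finally show "emeasure (distr ?M borel ?T) A = emeasure ?N A" .
qed simp

text \<open>
The circle is a double cover of the projective line, hence the factor \<open>2\<close> in the density. The
exceptional angles, where the cosine vanishes, form a countable set.
\<close>

lemma circle_integral_tan:
  fixes f F :: "real \<Rightarrow> complex"
  assumes [measurable]: "f \<in> borel_measurable borel" "F \<in> borel_measurable borel"
    and s: "0 \<le> s" "s \<le> 2 * pi"
    and f: "\<And>x. cos (x - s - pi / 2) \<noteq> 0 \<Longrightarrow> f x = F (tan (x - s - pi / 2))"
  shows "(LINT x:{0..2 * pi}|lborel. f x) = (LINT u|lborel. of_real (2 / (1 + u\<^sup>2)) * F u)"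
proof -
  define Z where "Z = {x. cos (x - s - pi / 2) = 0}"
  have "Z \<subseteq> range (\<lambda>n::int. s + pi / 2 + (of_int n * pi + pi / 2))"
  proof
    fix x assume "x \<in> Z"
    then obtain n :: int where "x - s - pi / 2 = of_int n * pi + pi / 2"
      unfolding Z_def using cos_zero_iff_int2[of "x - s - pi / 2"] by auto
    then have "x = s + pi / 2 + (of_int n * pi + pi / 2)" by simp
    then show "x \<in> range (\<lambda>n::int. s + pi / 2 + (of_int n * pi + pi / 2))" by blast
  qed
  then have "countable Z" by (rule countable_subset) auto
  then have "Z \<in> null_sets lborel" by (rule countable_imp_null_set_lborel)
  then have ae: "AE x in lborel. f x = F (tan (x - s - pi / 2))"
    by (rule eventually_mono[OF AE_not_in]) (auto simp: Z_def f)
  have "(LINT x:{0..2 * pi}|lborel. f x) = (LINT x|lborel. indicator {0..2 * pi} x *\<^sub>R F (tan (x - s - pi / 2)))"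
    unfolding set_lebesgue_integral_def
    by (rule integral_cong_AE) (use ae in \<open>measurable, auto elim: eventually_mono\<close>)
  also have "\<dots> = (LINT x|density lborel (\<lambda>x. ennreal (indicator {0..2 * pi} x)). F (tan (x - s - pi / 2)))"
    by (subst integral_density) auto
  also have "\<dots> = (LINT u|distr (density lborel (\<lambda>x. ennreal (indicator {0..2 * pi} x))) borel (\<lambda>x. tan (x - s - pi / 2)). F u)"
    by (subst integral_distr) auto
  also have "\<dots> = (LINT u|lborel. (2 / (1 + u\<^sup>2)) *\<^sub>R F u)"
    unfolding distr_tan_circle[OF s] by (subst integral_density) auto
  finally show ?thesis by (simp add: scaleR_conv_of_real)
qed



text \<open>
This is \<open>sin (\<xi> - \<eta>) = cos \<xi> * cos \<eta> * (tan \<xi> - tan \<eta>)\<close> together with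
\<open>(cos x)\<^sup>2 = 1 / (1 + (tan x)\<^sup>2)\<close>.
\<close>

lemma kernel_tan:
  assumes "cos \<xi> \<noteq> 0" "cos \<eta> \<noteq> 0"
  shows "complex_of_real \<bar>cos \<eta>\<bar> powr a * of_real \<bar>cos \<xi>\<bar> powr b * of_real \<bar>sin (\<xi> - \<eta>)\<bar> powr c =
    of_real (1 + (tan \<eta>)\<^sup>2) powr (- ((a + c) / 2)) * of_real (1 + (tan \<xi>)\<^sup>2) powr (- ((b + c) / 2)) *
    of_real \<bar>tan \<xi> - tan \<eta>\<bar> powr c"
proof -
  have cos_powr: "complex_of_real \<bar>cos x\<bar> powr s = of_real (1 + (tan x)\<^sup>2) powr (- (s / 2))" if "cos x \<noteq> 0" for x s
  proof -
    have "(cos x)\<^sup>2 = 1 / (1 + (tan x)\<^sup>2)"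
      using tan_sec[OF that] by (simp add: power_inverse field_simps)
    then have "complex_of_real \<bar>cos x\<bar> powr s = of_real (1 / (1 + (tan x)\<^sup>2)) powr (s / 2)"
      by (metis of_real_square_powr)
    also have "\<dots> = of_real 1 powr (s / 2) * of_real (1 + (tan x)\<^sup>2) powr (- (s / 2))"
      by (rule of_real_divide_powr) (auto intro: add_pos_nonneg)
    finally show ?thesis by simp
  qed
  have "sin (\<xi> - \<eta>) = cos \<xi> * cos \<eta> * (tan \<xi> - tan \<eta>)"
    using assms by (simp add: sin_diff tan_def field_simps)
  then have "\<bar>sin (\<xi> - \<eta>)\<bar> = \<bar>cos \<xi>\<bar> * (\<bar>cos \<eta>\<bar> * \<bar>tan \<xi> - tan \<eta>\<bar>)"
    by (simp add: abs_mult)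
  then have "complex_of_real \<bar>sin (\<xi> - \<eta>)\<bar> powr c =
      of_real \<bar>cos \<xi>\<bar> powr c * (of_real \<bar>cos \<eta>\<bar> powr c * of_real \<bar>tan \<xi> - tan \<eta>\<bar> powr c)"
    by (simp only: of_real_mult) (simp add: powr_times_real)
  moreover have "complex_of_real (1 + (tan x)\<^sup>2) powr (- ((s + c) / 2)) = of_real \<bar>cos x\<bar> powr s * of_real \<bar>cos x\<bar> powr c"
    if "cos x \<noteq> 0" for x s
    unfolding cos_powr[OF that] by (simp add: add_divide_distrib flip: powr_add)
  ultimately show ?thesis
    using assms by (simp add: mult_ac)
qed

text \<open>
With \<open>\<xi> = x - z - \<pi> / 2\<close> and \<open>\<eta> = y - z - \<pi> / 2\<close> the three sines become \<open>cos \<eta>\<close>, \<open>cos \<xi>\<close> and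
\<open>sin (\<xi> - \<eta>)\<close>, so that the value does not depend on \<open>z\<close>. The Jacobians of the two substitutions
add \<open>1\<close> to each of the exponents coming from \<open>kernel_tan\<close>.
\<close>

lemma circle_double_integral:
  assumes z: "0 \<le> z" "z \<le> 2 * pi"
  shows "(LINT y:{0..2*pi}|lborel. LINT x:{0..2*pi}|lborel.
      complex_of_real \<bar>sin (y - z)\<bar> powr a * complex_of_real \<bar>sin (x - z)\<bar> powr b * complex_of_real \<bar>sin (x - y)\<bar> powr c) =
    4 * (LINT v|lborel. LINT u|lborel. of_real (1 + v\<^sup>2) powr (- ((a + c) / 2 + 1)) *
        of_real (1 + u\<^sup>2) powr (- ((b + c) / 2 + 1)) * of_real \<bar>u - v\<bar> powr c)"
proof -
  define F where "F v u = complex_of_real (1 + v\<^sup>2) powr (- ((a + c) / 2)) *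
     of_real (1 + u\<^sup>2) powr (- ((b + c) / 2)) * of_real \<bar>u - v\<bar> powr c" for u v :: real
  define G where "G v = (LINT u|lborel. of_real (2 / (1 + u\<^sup>2)) * F v u)" for v
  define f where "f y x = complex_of_real \<bar>sin (y - z)\<bar> powr a * complex_of_real \<bar>sin (x - z)\<bar> powr b * complex_of_real \<bar>sin (x - y)\<bar> powr c" for x y
  have [measurable]: "(\<lambda>(y, x). f y x) \<in> borel_measurable (lborel \<Otimes>\<^sub>M lborel)"
    unfolding f_def by measurable
  have [measurable]: "(\<lambda>(v, u). F v u) \<in> borel_measurable (lborel \<Otimes>\<^sub>M lborel)"
    unfolding F_def by measurable
  have [measurable]: "f y \<in> borel_measurable borel" "F v \<in> borel_measurable borel" for y v
    unfolding f_def F_def by measurable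
  have f_F: "f y x = F (tan (y - z - pi / 2)) (tan (x - z - pi / 2))"
    if "cos (x - z - pi / 2) \<noteq> 0" "cos (y - z - pi / 2) \<noteq> 0" for x y
  proof -
    have "sin (x - z) = cos (x - z - pi / 2)" "sin (y - z) = cos (y - z - pi / 2)" by (simp_all add: cos_diff)
    moreover have "x - y = (x - z - pi / 2) - (y - z - pi / 2)" by simp
    ultimately show ?thesis unfolding f_def F_def by (metis kernel_tan[OF that])
  qed
  have "(LINT y:{0..2*pi}|lborel. LINT x:{0..2*pi}|lborel. f y x) = (LINT v|lborel. of_real (2 / (1 + v\<^sup>2)) * G v)"
  proof (rule circle_integral_tan[OF _ _ z])
    show "(\<lambda>y. LINT x:{0..2*pi}|lborel. f y x) \<in> borel_measurable borel"
      unfolding set_lebesgue_integral_def by measurable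
    show "G \<in> borel_measurable borel" unfolding G_def by measurable
    show "(LINT x:{0..2*pi}|lborel. f y x) = G (tan (y - z - pi / 2))" if "cos (y - z - pi / 2) \<noteq> 0" for y
      unfolding G_def by (rule circle_integral_tan[OF _ _ z]) (use f_F that in auto)
  qed
  also have "\<dots> = (LINT v|lborel. 4 * (LINT u|lborel. of_real (1 + v\<^sup>2) powr (- ((a + c) / 2 + 1)) *
        of_real (1 + u\<^sup>2) powr (- ((b + c) / 2 + 1)) * of_real \<bar>u - v\<bar> powr c))"
  proof (rule Bochner_Integration.integral_cong[OF refl])
    fix v :: real
    have pow: "complex_of_real (1 + x\<^sup>2) powr (- (s + 1)) = of_real (1 + x\<^sup>2) powr (- s) * of_real (1 / (1 + x\<^sup>2))" for x s
    proof -
      have "complex_of_real (1 + x\<^sup>2) \<noteq> 0" by (simp only: of_real_eq_0_iff) (simp add: add_nonneg_eq_0_iff)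
      then show ?thesis by (simp only: minus_add_distrib powr_add powr_minus[of _ 1] powr_to_1) (simp add: field_simps)
    qed
    have "of_real (2 / (1 + v\<^sup>2)) * G v = (LINT u|lborel. of_real (2 / (1 + v\<^sup>2)) * (of_real (2 / (1 + u\<^sup>2)) * F v u))"
      unfolding G_def by (rule integral_mult_right_zero[symmetric])
    also have "\<dots> = (LINT u|lborel. 4 * (of_real (1 + v\<^sup>2) powr (- ((a + c) / 2 + 1)) *
        of_real (1 + u\<^sup>2) powr (- ((b + c) / 2 + 1)) * of_real \<bar>u - v\<bar> powr c))"
    proof (rule Bochner_Integration.integral_cong[OF refl])
      fix u :: real
      have two: "complex_of_real (2 / X) = 2 * of_real (1 / X)" for X by simp
      have "2 * v' * (2 * u' * (P * Q * R)) = 4 * (P * v' * (Q * u') * R)" for P Q R u' v' :: complex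
        by simp
      then show "of_real (2 / (1 + v\<^sup>2)) * (of_real (2 / (1 + u\<^sup>2)) * F v u) =
          4 * (of_real (1 + v\<^sup>2) powr (- ((a + c) / 2 + 1)) *
            of_real (1 + u\<^sup>2) powr (- ((b + c) / 2 + 1)) * of_real \<bar>u - v\<bar> powr c)"
        unfolding F_def pow two .
    qed
    also have "\<dots> = 4 * (LINT u|lborel. of_real (1 + v\<^sup>2) powr (- ((a + c) / 2 + 1)) *
        of_real (1 + u\<^sup>2) powr (- ((b + c) / 2 + 1)) * of_real \<bar>u - v\<bar> powr c)"
      by (rule integral_mult_right_zero)
    finally show "of_real (2 / (1 + v\<^sup>2)) * G v = 4 * (LINT u|lborel. of_real (1 + v\<^sup>2) powr (- ((a + c) / 2 + 1)) *
        of_real (1 + u\<^sup>2) powr (- ((b + c) / 2 + 1)) * of_real \<bar>u - v\<bar> powr c)" .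
  qed
  also have "\<dots> = 4 * (LINT v|lborel. LINT u|lborel. of_real (1 + v\<^sup>2) powr (- ((a + c) / 2 + 1)) *
        of_real (1 + u\<^sup>2) powr (- ((b + c) / 2 + 1)) * of_real \<bar>u - v\<bar> powr c)"
    by (rule integral_mult_right_zero)
  finally show ?thesis unfolding f_def .
qed

section \<open>The functional on the unit vectors\<close>

lemma circle_model_e_vec [simp]: "circle_model (e_vec \<mu>) \<theta> = 1"
  by (simp add: circle_model_def e_vec_eq norm_Pair)

text \<open>
In these parameters the four Beta functions of \<open>kernel_iterated_integral\<close> collapse: the factors
\<open>\<Gamma>(A + B + 2 C)\<close> and \<open>\<Gamma>(A + B + 2 C - 1 / 2)\<close> cancel, and the symmetry of the original
integral becomes visible.
\<close>

lemma double_integral_Gamma: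
  assumes "Re A > 0" "Re B > 0" "Re C > 0" "Re (A + B + C) > 1 / 2"
  shows "(LINT v|lborel. LINT u|lborel. of_real (1 + v\<^sup>2) powr (- (A + C)) * of_real (1 + u\<^sup>2) powr (- (B + C)) *
      of_real \<bar>u - v\<bar> powr (2 * C - 1)) =
    of_real (sqrt pi) * (Gamma A * Gamma B * Gamma C * Gamma (A + B + C - 1 / 2)) /
      (Gamma (A + B) * Gamma (A + C) * Gamma (B + C))"
proof -
  have nz: "Gamma w \<noteq> 0" if "Re w > 0" for w :: complex
    using that by (auto simp: Gamma_eq_zero_iff elim!: nonpos_Ints_cases)
  have rational: "(g * s / h) * (d * c / g) * (a * b / ab) / (ac * bc / h) = s * (a * b * c * d) / (ab * ac * bc)"
    if "g \<noteq> 0" "h \<noteq> 0" for a b c d s g h ab ac bc :: complex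
    using that by (simp add: field_simps)
  have "(LINT v|lborel. LINT u|lborel. of_real (1 + v\<^sup>2) powr (- (A + C)) * of_real (1 + u\<^sup>2) powr (- (B + C)) *
      of_real \<bar>u - v\<bar> powr (2 * C - 1)) =
    Beta (A + C + (B + C) - 1 / 2) (1 / 2) * Beta (A + C + (B + C) - (2 * C - 1) / 2 - 1) ((2 * C - 1 + 1) / 2) *
    Beta (A + C - (2 * C - 1 + 1) / 2) (B + C - (2 * C - 1 + 1) / 2) / Beta (A + C) (B + C)"
    using assms by (intro kernel_iterated_integral) (auto simp: diff_divide_distrib)
  also have "(2 * C - 1 + 1) / 2 = C" by simp
  also have "A + C + (B + C) - (2 * C - 1) / 2 - 1 = A + B + C - 1 / 2" by (simp add: diff_divide_distrib)
  also have "Beta (A + C + (B + C) - 1 / 2) (1 / 2) =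
      Gamma (A + C + (B + C) - 1 / 2) * of_real (sqrt pi) / Gamma (A + C + (B + C))"
    unfolding Beta_def Gamma_one_half_complex by simp
  also have "Beta (A + B + C - 1 / 2) C = Gamma (A + B + C - 1 / 2) * Gamma C / Gamma (A + C + (B + C) - 1 / 2)"
  proof -
    have "A + B + C - 1 / 2 + C = A + C + (B + C) - 1 / 2" by simp
    then show ?thesis by (simp only: Beta_def)
  qed
  also have "Beta (A + C - C) (B + C - C) = Gamma A * Gamma B / Gamma (A + B)"
    by (simp add: Beta_def)
  also have "Beta (A + C) (B + C) = Gamma (A + C) * Gamma (B + C) / Gamma (A + C + (B + C))"
    by (simp add: Beta_def)
  also have "Gamma (A + C + (B + C) - 1 / 2) * of_real (sqrt pi) / Gamma (A + C + (B + C)) *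
      (Gamma (A + B + C - 1 / 2) * Gamma C / Gamma (A + C + (B + C) - 1 / 2)) * (Gamma A * Gamma B / Gamma (A + B)) /
      (Gamma (A + C) * Gamma (B + C) / Gamma (A + C + (B + C))) =
    of_real (sqrt pi) * (Gamma A * Gamma B * Gamma C * Gamma (A + B + C - 1 / 2)) /
      (Gamma (A + B) * Gamma (A + C) * Gamma (B + C))"
    using assms by (intro rational nz) auto
  finally show ?thesis .
qed

text \<open>
The exponents of the three sines are \<open>2 A - 1\<close>, \<open>2 B - 1\<close> and \<open>2 C - 1\<close>, and
\<open>A + B + C = D + 1 / 2\<close>; the integration over the third angle only multiplies by \<open>2 \<pi>\<close>.
\<close>

lemma l_mod_e_vec_Gamma:
  fixes \<mu>\<^sub>1 \<mu>\<^sub>2 \<mu>\<^sub>3 :: complex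
  defines "A \<equiv> (1 + \<mu>\<^sub>1 - \<mu>\<^sub>2 - \<mu>\<^sub>3) / 4" and "B \<equiv> (1 - \<mu>\<^sub>1 + \<mu>\<^sub>2 - \<mu>\<^sub>3) / 4"
    and "C \<equiv> (1 - \<mu>\<^sub>1 - \<mu>\<^sub>2 + \<mu>\<^sub>3) / 4" and "D \<equiv> (1 - \<mu>\<^sub>1 - \<mu>\<^sub>2 - \<mu>\<^sub>3) / 4"
  assumes "Re A > 0" "Re B > 0" "Re C > 0" "Re D > 0"
  shows "l_mod \<mu>\<^sub>1 \<mu>\<^sub>2 \<mu>\<^sub>3 (e_vec \<mu>\<^sub>1) (e_vec \<mu>\<^sub>2) (e_vec \<mu>\<^sub>3) =
    of_real (sqrt pi / pi ^ 2) * (Gamma A * Gamma B * Gamma C * Gamma D) /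
      (Gamma ((1 - \<mu>\<^sub>1) / 2) * Gamma ((1 - \<mu>\<^sub>2) / 2) * Gamma ((1 - \<mu>\<^sub>3) / 2))"
proof -
  define K where "K = (LINT v|lborel. LINT u|lborel. of_real (1 + v\<^sup>2) powr (- (A + C)) * of_real (1 + u\<^sup>2) powr (- (B + C)) *
      complex_of_real \<bar>u - v\<bar> powr (2 * C - 1))"
  have e: "(\<mu>\<^sub>1 - \<mu>\<^sub>2 - \<mu>\<^sub>3 - 1) / 2 = 2 * A - 1" "(- \<mu>\<^sub>1 + \<mu>\<^sub>2 - \<mu>\<^sub>3 - 1) / 2 = 2 * B - 1" "(- \<mu>\<^sub>1 - \<mu>\<^sub>2 + \<mu>\<^sub>3 - 1) / 2 = 2 * C - 1"
    by (simp_all add: A_def B_def C_def field_simps)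
  have g: "(2 * A - 1 + (2 * C - 1)) / 2 + 1 = A + C" "(2 * B - 1 + (2 * C - 1)) / 2 + 1 = B + C"
    by (simp_all add: field_simps)
  have "l_mod \<mu>\<^sub>1 \<mu>\<^sub>2 \<mu>\<^sub>3 (e_vec \<mu>\<^sub>1) (e_vec \<mu>\<^sub>2) (e_vec \<mu>\<^sub>3) =
      1 / complex_of_real (2 * pi) ^ 3 * (LINT z:{0..2*pi}|lborel. 4 * K)"
  proof -
    have "(LINT y:{0..2*pi}|lborel. LINT x:{0..2*pi}|lborel.
        complex_of_real \<bar>sin (y - z)\<bar> powr (2 * A - 1) * complex_of_real \<bar>sin (x - z)\<bar> powr (2 * B - 1) *
        complex_of_real \<bar>sin (x - y)\<bar> powr (2 * C - 1)) = 4 * K" if "z \<in> {0..2*pi}" for z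
      using circle_double_integral[of z "2 * A - 1" "2 * B - 1" "2 * C - 1"] that unfolding g K_def by simp
    then show ?thesis
      unfolding l_mod_def Let_def e circle_model_e_vec mult_1_left
      by (intro arg_cong2[where f = "(*)"] refl set_lebesgue_integral_cong) auto
  qed
  also have "\<dots> = 1 / complex_of_real (2 * pi) ^ 3 * (of_real (2 * pi) * (4 * K))"
    by (subst set_integral_const) (auto simp: scaleR_conv_of_real)
  also have "\<dots> = of_real (1 / pi ^ 2) * K"
    by (simp add: field_simps power2_eq_square power3_eq_cube)
  also have "K = of_real (sqrt pi) * (Gamma A * Gamma B * Gamma C * Gamma (A + B + C - 1 / 2)) /
      (Gamma (A + B) * Gamma (A + C) * Gamma (B + C))"
    unfolding K_def
  proof (rule double_integral_Gamma)
    have "A + B + C = D + 1 / 2" by (simp add: A_def B_def C_def D_def field_simps)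
    then show "Re (A + B + C) > 1 / 2" using assms by simp
  qed (use assms in auto)
  also have "A + B + C - 1 / 2 = D" by (simp add: A_def B_def C_def D_def field_simps)
  also have "A + B = (1 - \<mu>\<^sub>3) / 2" by (simp add: A_def B_def field_simps)
  also have "A + C = (1 - \<mu>\<^sub>2) / 2" by (simp add: A_def C_def field_simps)
  also have "B + C = (1 - \<mu>\<^sub>1) / 2" by (simp add: B_def C_def field_simps)
  finally show ?thesis by (simp add: mult_ac)
qed

section \<open>The Gamma function on vertical lines\<close>

lemma abs_ln_one_plus_le:
  fixes x :: real
  assumes "\<bar>x\<bar> \<le> 1/2"
  shows "\<bar>ln (1 + x)\<bar> \<le> 2 * \<bar>x\<bar>"
proof -
  have "\<bar>ln (1 + x)\<bar> \<le> \<bar>x\<bar> + 2 * \<bar>x\<bar> * \<bar>x\<bar>"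
    using abs_ln_one_plus_x_minus_x_bound[OF assms] by (simp add: power2_eq_square abs_if split: if_splits)
  also have "2 * \<bar>x\<bar> * \<bar>x\<bar> \<le> 1 * \<bar>x\<bar>" using assms by (intro mult_right_mono) auto
  finally show ?thesis by simp
qed

text \<open>
Dividing Gauss's product formulas for \<open>\<Gamma>(z)\<close> and \<open>\<Gamma>(z + 1 / 2)\<close>, the factorials cancel and the
two powers of \<open>n\<close> leave \<open>1 / sqrt n\<close>.
\<close>

lemma Gamma_half_shift_limit:
  fixes z :: complex
  assumes "z \<notin> \<int>\<^sub>\<le>\<^sub>0" "z + 1/2 \<notin> \<int>\<^sub>\<le>\<^sub>0"
  shows "(\<lambda>n. (norm (pochhammer (z + 1/2) n) / norm (pochhammer z n))\<^sup>2 / real n)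
           \<longlonglongrightarrow> (norm (Gamma z / Gamma (z + 1/2)))\<^sup>2"
proof -
  have "(\<lambda>n. (norm (Gamma_series' z n / Gamma_series' (z + 1/2) n))\<^sup>2) \<longlonglongrightarrow> (norm (Gamma z / Gamma (z + 1/2)))\<^sup>2"
    using assms by (intro tendsto_intros Gamma_series'_LIMSEQ) (auto simp: Gamma_eq_zero_iff)
  moreover have "eventually (\<lambda>n. (norm (Gamma_series' z n / Gamma_series' (z + 1/2) n))\<^sup>2 =
      (norm (pochhammer (z + 1/2) n) / norm (pochhammer z n))\<^sup>2 / real n) sequentially"
    using eventually_gt_at_top[of 0]
  proof eventually_elim
    case (elim n)
    have "Gamma_series' z n / Gamma_series' (z + 1/2) n =
        (exp (z * of_real (ln n)) / exp ((z + 1/2) * of_real (ln n))) * (pochhammer (z + 1/2) n / pochhammer z n)"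
      by (simp add: Gamma_series'_def field_simps)
    also have "exp (z * of_real (ln n)) / exp ((z + 1/2) * of_real (ln n)) = exp (- complex_of_real (ln n / 2))"
      by (simp flip: exp_diff add: algebra_simps)
    also have "norm (exp (- complex_of_real (ln n / 2)) * (pochhammer (z + 1/2) n / pochhammer z n)) =
        exp (- (ln n / 2)) * (norm (pochhammer (z + 1/2) n) / norm (pochhammer z n))"
      by (simp add: norm_mult norm_divide)
    also have "(exp (- (ln n / 2)) * (norm (pochhammer (z + 1/2) n) / norm (pochhammer z n)))\<^sup>2 =
       (norm (pochhammer (z + 1/2) n) / norm (pochhammer z n))\<^sup>2 / real n"
    proof -
      have "(exp (- (ln (real n) / 2)))\<^sup>2 = 1 / real n"
        using elim by (simp flip: exp_double add: exp_minus field_simps)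
      then show ?thesis by (simp only: power_mult_distrib) simp
    qed
    finally show ?case .
  qed
  ultimately show ?thesis by (rule Lim_transform_eventually)
qed

text \<open>
Since \<open>(k + u) * (k + 1 + u) \<le> 2 * ((k + 1 / 2)\<^sup>2 + u\<^sup>2)\<close>, the sum is dominated by a telescoping one.
\<close>

lemma sum_inverse_shifted_squares_le:
  fixes u :: real
  assumes "u > 0"
  shows "(\<Sum>k<n. 1 / ((real k + 1/2)\<^sup>2 + u\<^sup>2)) \<le> 2 / u"
proof -
  have "(\<Sum>k<n. 1 / ((real k + 1/2)\<^sup>2 + u\<^sup>2)) \<le> (\<Sum>k<n. 2 / (real k + u) - 2 / (real (Suc k) + u))"
  proof (rule sum_mono)
    fix k :: nat
    define M where "M = (real k + 1/2)\<^sup>2 + u\<^sup>2"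
    have M: "(real k + u) * (real k + 1 + u) \<le> 2 * M"
      using zero_le_power2[of "real k + 1/2 - u"] by (simp add: M_def power2_eq_square algebra_simps)
    have pos: "0 < (real k + u) * (real k + 1 + u)" using assms by simp
    have "M > 0" using M pos by linarith
    have "1 / M = 2 / (2 * M)" by simp
    also have "\<dots> \<le> 2 / ((real k + u) * (real k + 1 + u))"
      using M pos assms \<open>M > 0\<close> by (intro divide_left_mono mult_pos_pos) auto
    also have "\<dots> = 2 / (real k + u) - 2 / (real (Suc k) + u)"
      using assms by (simp add: field_simps)
    finally show "1 / ((real k + 1/2)\<^sup>2 + u\<^sup>2) \<le> 2 / (real k + u) - 2 / (real (Suc k) + u)"
      unfolding M_def .
  qed
  also have "\<dots> = 2 / u - 2 / (real n + u)"
    by (subst sum_lessThan_telescope') simp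
  also have "\<dots> \<le> 2 / u" using assms by simp
  finally show ?thesis .
qed

text \<open>
Put \<open>m k = z + k + 1 / 2\<close>. Then \<open>(z + k) * (z + k + 1) = (m k)\<^sup>2 - 1 / 4\<close>, so that distributing the
squares of the factors \<open>z + k\<close> over neighbouring indices turns the quotient into the product of
the inverses of \<open>\<bar>1 - 1 / (4 (m k)\<^sup>2)\<bar>\<close>. Each logarithm is of order \<open>1 / \<bar>m k\<bar>\<^sup>2\<close>, and these
bounds sum to \<open>O(1 / \<bar>Im z\<bar>)\<close> uniformly in \<open>n\<close>.
\<close>

lemma pochhammer_half_shift_bound:
  fixes z :: complex
  assumes "Re z \<ge> 0" "\<bar>Im z\<bar> \<ge> 1"
  shows "\<bar>ln ((norm (pochhammer (z + 1/2) n) / norm (pochhammer z n))\<^sup>2 * norm z / norm (z + of_nat n))\<bar> \<le> 1 / \<bar>Im z\<bar>"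
proof -
  define m where "m k = z + of_nat k + 1/2" for k
  have nz: "z + of_nat k \<noteq> 0" for k using assms(2) by (auto simp: complex_eq_iff)
  have mz: "m k \<noteq> 0" for k using assms(2) by (auto simp: complex_eq_iff m_def)
  have m2: "(norm (m k))\<^sup>2 \<ge> (real k + 1/2)\<^sup>2 + \<bar>Im z\<bar>\<^sup>2" for k
    using assms unfolding cmod_power2 m_def by (auto intro!: power_mono add_mono)
  have m1: "(norm (m k))\<^sup>2 \<ge> 1" for k
  proof -
    have "1 \<le> \<bar>Im z\<bar>\<^sup>2" using assms(2) by (rule one_le_power)
    with m2[of k] show ?thesis by (smt (verit) zero_le_power2)
  qed
  define d where "d k = norm (1 - 1 / (4 * (m k)\<^sup>2)) - 1" for k
  have d: "\<bar>d k\<bar> \<le> 1 / (4 * (norm (m k))\<^sup>2)" for k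
  proof -
    have "\<bar>d k\<bar> \<le> norm ((1 - 1 / (4 * (m k)\<^sup>2)) - 1)"
      unfolding d_def using norm_triangle_ineq3[of "1 - 1 / (4 * (m k)\<^sup>2)" 1] by simp
    then show ?thesis by (simp add: norm_divide norm_mult norm_power)
  qed
  have d': "\<bar>d k\<bar> \<le> 1/2" for k
    using d[of k] m1[of k] by (smt (verit) divide_left_mono frac_le mult_less_cancel_left_pos)
  have d_pos: "1 + d k > 0" for k using d'[of k] by linarith
  have "(norm (pochhammer (z + 1/2) n) / norm (pochhammer z n))\<^sup>2 * norm z / norm (z + of_nat n) = (\<Prod>k<n. inverse (1 + d k))" for n
  proof (induction n)
    case 0
    show ?case using nz[of 0] by simp
  next
    case (Suc n)
    have e: "1 - 1 / (4 * (m n)\<^sup>2) = (z + of_nat n) * (z + of_nat (Suc n)) / (m n)\<^sup>2"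
    proof -
      have "(z + of_nat n) * (z + of_nat (Suc n)) = (m n)\<^sup>2 - 1 / 4"
        by (simp add: m_def power2_eq_square algebra_simps)
      moreover have "1 - 1 / (4 * M) = (M - 1 / 4) / M" if "M \<noteq> 0" for M :: complex
        using that by (simp add: field_simps)
      ultimately show ?thesis using mz[of n] by simp
    qed
    have "1 + d n = norm (z + of_nat n) * norm (z + of_nat (Suc n)) / (norm (m n))\<^sup>2"
      unfolding d_def e by (simp add: norm_mult norm_divide norm_power)
    then have s: "inverse (1 + d n) = (norm (m n))\<^sup>2 / (norm (z + of_nat n) * norm (z + of_nat (Suc n)))"
      by simp
    have "(norm (pochhammer (z + 1/2) (Suc n)) / norm (pochhammer z (Suc n)))\<^sup>2 * norm z / norm (z + of_nat (Suc n))
        = ((norm (pochhammer (z + 1/2) n) / norm (pochhammer z n))\<^sup>2 * norm z / norm (z + of_nat n)) * inverse (1 + d n)"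
      unfolding s using nz[of n] nz[of "Suc n"]
      by (simp add: pochhammer_Suc norm_mult m_def power_mult_distrib power_divide power2_eq_square add_ac divide_simps)
    also have "\<dots> = (\<Prod>k<Suc n. inverse (1 + d k))" by (simp add: Suc.IH)
    finally show ?case .
  qed
  then have "ln ((norm (pochhammer (z + 1/2) n) / norm (pochhammer z n))\<^sup>2 * norm z / norm (z + of_nat n)) = (\<Sum>k<n. - ln (1 + d k))"
    using d_pos by (simp add: ln_prod ln_inverse less_imp_neq[symmetric])
  also have "\<bar>\<dots>\<bar> \<le> (\<Sum>k<n. \<bar>- ln (1 + d k)\<bar>)" by (rule sum_abs)
  also have "\<dots> \<le> (\<Sum>k<n. (1/2) * (1 / ((real k + 1/2)\<^sup>2 + \<bar>Im z\<bar>\<^sup>2)))"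
  proof (rule sum_mono)
    fix k
    have "\<bar>- ln (1 + d k)\<bar> \<le> 2 * \<bar>d k\<bar>" using abs_ln_one_plus_le[OF d'] by simp
    also have "\<dots> \<le> 2 * (1 / (4 * (norm (m k))\<^sup>2))" using d by (intro mult_left_mono) auto
    also have "\<dots> = (1/2) * (1 / (norm (m k))\<^sup>2)" by simp
    also have "\<dots> \<le> (1/2) * (1 / ((real k + 1/2)\<^sup>2 + \<bar>Im z\<bar>\<^sup>2))"
      using m2[of k] assms(2) by (intro mult_left_mono divide_left_mono mult_pos_pos) (auto intro!: add_pos_nonneg simp: mz)
    finally show "\<bar>- ln (1 + d k)\<bar> \<le> (1/2) * (1 / ((real k + 1/2)\<^sup>2 + \<bar>Im z\<bar>\<^sup>2))" .
  qed
  also have "\<dots> \<le> (1/2) * (2 / \<bar>Im z\<bar>)"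
    unfolding sum_distrib_left[symmetric] using assms
    by (intro mult_left_mono sum_inverse_shifted_squares_le) auto
  finally show ?thesis by simp
qed

text \<open>
The quotient \<open>\<bar>\<Gamma>(z) / \<Gamma>(z + 1 / 2)\<bar>\<^sup>2\<close> is \<open>1 / \<bar>z\<bar>\<close> up to a relative error \<open>O(1 / \<bar>Im z\<bar>)\<close>: let
\<open>n\<close> tend to infinity in the preceding uniform bound, in which \<open>\<bar>z + n\<bar>\<close> may be replaced by \<open>n\<close>.
\<close>

lemma Gamma_half_shift_bound:
  fixes z :: complex
  assumes "Re z \<ge> 0" "\<bar>Im z\<bar> \<ge> 1"
  shows "\<bar>ln ((norm (Gamma z / Gamma (z + 1/2)))\<^sup>2 * norm z)\<bar> \<le> 1 / \<bar>Im z\<bar>"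
proof -
  have nonint: "w \<notin> \<int>\<^sub>\<le>\<^sub>0" if "Im w = Im z" for w
    using that assms by (auto elim!: nonpos_Ints_cases)
  have "(\<lambda>n. norm (z / of_nat n + 1)) \<longlonglongrightarrow> norm (0 + 1 :: complex)"
    by (intro tendsto_intros lim_const_over_n)
  moreover have "eventually (\<lambda>n. norm (z / of_nat n + 1) = norm (z + of_nat n) / real n) sequentially"
    using eventually_gt_at_top[of 0] proof eventually_elim
    case (elim n)
    then have "z / of_nat n + 1 = (z + of_nat n) / of_nat n" by (simp add: field_simps)
    then show ?case by (simp add: norm_divide)
  qed
  ultimately have "(\<lambda>n. norm (z + of_nat n) / real n) \<longlonglongrightarrow> norm (0 + 1 :: complex)"
    by (rule Lim_transform_eventually)
  moreover have "(\<lambda>n. (norm (pochhammer (z + 1/2) n) / norm (pochhammer z n))\<^sup>2 / real n) \<longlonglongrightarrow> (norm (Gamma z / Gamma (z + 1/2)))\<^sup>2"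
    by (intro Gamma_half_shift_limit nonint) auto
  ultimately have "(\<lambda>n. ln ((norm (pochhammer (z + 1/2) n) / norm (pochhammer z n))\<^sup>2 / real n * norm z / (norm (z + of_nat n) / real n)))
      \<longlonglongrightarrow> ln ((norm (Gamma z / Gamma (z + 1/2)))\<^sup>2 * norm z / norm (0 + 1 :: complex))"
    using nonint[of z] nonint[of "z + 1/2"] assms
    by (intro tendsto_intros) (auto simp: Gamma_eq_zero_iff)
  moreover have "eventually (\<lambda>n. ln ((norm (pochhammer (z + 1/2) n) / norm (pochhammer z n))\<^sup>2 / real n * norm z / (norm (z + of_nat n) / real n)) =
      ln ((norm (pochhammer (z + 1/2) n) / norm (pochhammer z n))\<^sup>2 * norm z / norm (z + of_nat n))) sequentially"
    using eventually_gt_at_top[of 0] by eventually_elim (simp add: field_simps)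
  ultimately have "(\<lambda>n. ln ((norm (pochhammer (z + 1/2) n) / norm (pochhammer z n))\<^sup>2 * norm z / norm (z + of_nat n)))
      \<longlonglongrightarrow> ln ((norm (Gamma z / Gamma (z + 1/2)))\<^sup>2 * norm z)"
    by (simp add: tendsto_cong)
  then have "(\<lambda>n. \<bar>ln ((norm (pochhammer (z + 1/2) n) / norm (pochhammer z n))\<^sup>2 * norm z / norm (z + of_nat n))\<bar>)
      \<longlonglongrightarrow> \<bar>ln ((norm (Gamma z / Gamma (z + 1/2)))\<^sup>2 * norm z)\<bar>"
    by (rule tendsto_rabs)
  then show ?thesis
    by (rule tendsto_upperbound) (use pochhammer_half_shift_bound[OF assms] in auto)
qed

text \<open>
On this line \<open>1 - z\<close> is the complex conjugate of \<open>z\<close>, so the reflection formula computes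
\<open>\<bar>\<Gamma>(z)\<bar>\<^sup>2\<close>.
\<close>

lemma Gamma_norm_line_half:
  "(norm (Gamma (Complex (1/2) y)))\<^sup>2 = pi / cosh (pi * y)"
proof -
  have "Gamma (Complex (1/2) y) * Gamma (1 - Complex (1/2) y) = of_real pi / sin (of_real pi * Complex (1/2) y)"
    by (rule Gamma_reflection_complex)
  moreover have "1 - Complex (1/2) y = cnj (Complex (1/2) y)" by (simp add: complex_eq_iff)
  moreover have "sin (of_real pi * Complex (1/2) y) = of_real (cosh (pi * y))"
    by (simp add: complex_eq_iff Re_sin Im_sin cosh_def)
  ultimately have "complex_of_real ((norm (Gamma (Complex (1/2) y)))\<^sup>2) = complex_of_real (pi / cosh (pi * y))"
    by (simp only: complex_norm_square cnj_Gamma) simp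
  then show ?thesis by (simp only: of_real_eq_iff)
qed

lemma ln_cosh_bound:
  fixes x :: real
  assumes "x \<noteq> 0"
  shows "\<bar>ln (cosh x) - (\<bar>x\<bar> - ln 2)\<bar> \<le> 1 / \<bar>x\<bar>"
proof -
  have cosh_eq: "cosh x = exp \<bar>x\<bar> / 2 * (1 + exp (- 2 * \<bar>x\<bar>))"
    by (cases "x \<ge> 0") (simp_all add: cosh_def algebra_simps flip: exp_add)
  have "ln (cosh x) = ln (exp \<bar>x\<bar> / 2) + ln (1 + exp (- 2 * \<bar>x\<bar>))"
    unfolding cosh_eq by (rule ln_mult_pos) (auto intro: add_pos_pos)
  then have eq: "ln (cosh x) - (\<bar>x\<bar> - ln 2) = ln (1 + exp (- 2 * \<bar>x\<bar>))"
    by (simp add: ln_div)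
  have "ln (1 + exp (- 2 * \<bar>x\<bar>)) \<le> exp (- 2 * \<bar>x\<bar>)" by (rule ln_add_one_self_le_self2) (smt (verit) exp_gt_zero)
  also have "\<dots> = 1 / exp (2 * \<bar>x\<bar>)" by (simp add: exp_minus field_simps)
  also have "\<dots> \<le> 1 / \<bar>x\<bar>"
  proof (intro divide_left_mono)
    show "\<bar>x\<bar> \<le> exp (2 * \<bar>x\<bar>)" using exp_ge_add_one_self[of "2 * \<bar>x\<bar>"] by linarith
  qed (use assms in auto)
  finally have "ln (1 + exp (- 2 * \<bar>x\<bar>)) \<le> 1 / \<bar>x\<bar>" .
  moreover have "ln (1 + exp (- 2 * \<bar>x\<bar>)) \<ge> 0" by simp
  ultimately show ?thesis unfolding eq by simp
qed

text \<open>
For \<open>Re z = 1 / 4\<close> the number \<open>1 - z\<close> is the complex conjugate of \<open>z + 1 / 2\<close>. Hence the reflection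
formula gives the product \<open>X * Y\<close> of \<open>X = \<bar>\<Gamma>(z)\<bar>\<close> and \<open>Y = \<bar>\<Gamma>(z + 1 / 2)\<bar>\<close>, while
\<open>Gamma_half_shift_bound\<close> controls \<open>X / Y\<close>; then \<open>X\<^sup>2 = (X * Y) * (X / Y)\<close>.
\<close>

lemma ln_Gamma_line_quarter:
  assumes "\<bar>u\<bar> \<ge> 1"
  shows "\<bar>ln ((norm (Gamma (Complex (1/4) u)))\<^sup>2) - (ln (2 * pi) - ln \<bar>u\<bar> / 2 - pi * \<bar>u\<bar>)\<bar> \<le> 2 / \<bar>u\<bar>"
proof -
  define z where "z = Complex (1/4) u"
  define X where "X = norm (Gamma z)"
  define Y where "Y = norm (Gamma (z + 1/2))"
  have nonint: "w \<notin> \<int>\<^sub>\<le>\<^sub>0" if "Im w = u" for w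
    using that assms by (auto elim!: nonpos_Ints_cases)
  have pos: "X > 0" "Y > 0"
    using nonint[of z] nonint[of "z + 1/2"] by (auto simp: X_def Y_def Gamma_eq_zero_iff z_def)
  have z: "norm z > 0" using assms by (auto simp: z_def complex_eq_iff)
  have shift: "\<bar>ln ((X / Y)\<^sup>2 * norm z)\<bar> \<le> 1 / \<bar>u\<bar>"
    using Gamma_half_shift_bound[of z] assms by (simp add: z_def X_def Y_def norm_divide)
  have "1 - z = cnj (z + 1/2)" by (simp add: complex_eq_iff z_def)
  then have "Gamma (1 - z) = cnj (Gamma (z + 1/2))" by (simp only: cnj_Gamma)
  then have "X * Y = pi / norm (sin (of_real pi * z))"
    using arg_cong[OF Gamma_reflection_complex[of z], of norm]
    by (simp add: norm_mult norm_divide X_def Y_def)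
  moreover have "norm (sin (of_real pi * z)) = sqrt (cosh (2 * pi * u) / 2)"
  proof -
    have "(norm (sin (of_real pi * z)))\<^sup>2 = cosh (2 * pi * u) / 2"
      by (simp add: norm_sin_squared z_def cosh_def exp_minus field_simps)
    then show ?thesis by (metis norm_ge_zero real_sqrt_abs abs_of_nonneg)
  qed
  ultimately have XY: "ln (X * Y) = ln pi - (ln (cosh (2 * pi * u)) - ln 2) / 2"
    by (simp add: ln_div ln_sqrt cosh_real_pos)
  have "ln (X\<^sup>2) = ln ((X / Y)\<^sup>2 * norm z) / 2 - ln (norm z) / 2 + ln (X * Y)"
    using pos z by (simp add: ln_mult ln_div ln_realpow field_simps)
  then have eq: "ln (X\<^sup>2) - (ln (2 * pi) - ln \<bar>u\<bar> / 2 - pi * \<bar>u\<bar>) =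
      ln ((X / Y)\<^sup>2 * norm z) / 2 - (ln (norm z) - ln \<bar>u\<bar>) / 2
        - (ln (cosh (2 * pi * u)) - (\<bar>2 * pi * u\<bar> - ln 2)) / 2"
    unfolding XY by (simp add: ln_mult abs_mult field_simps)
  have "\<bar>ln (cosh (2 * pi * u)) - (\<bar>2 * pi * u\<bar> - ln 2)\<bar> \<le> 1 / \<bar>2 * pi * u\<bar>"
    using assms by (intro ln_cosh_bound) auto
  also have "\<dots> \<le> 1 / \<bar>u\<bar>"
    using assms pi_gt3 by (intro divide_left_mono) (auto simp: abs_mult mult_le_cancel_right1)
  finally have b1: "\<bar>ln (cosh (2 * pi * u)) - (\<bar>2 * pi * u\<bar> - ln 2)\<bar> \<le> 1 / \<bar>u\<bar>" .
  have zu: "\<bar>u\<bar> \<le> norm z" "norm z \<le> \<bar>u\<bar> + 1/4"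
    using abs_Im_le_cmod[of z] cmod_le[of z] by (auto simp: z_def)
  have "ln (norm z) - ln \<bar>u\<bar> = ln (norm z / \<bar>u\<bar>)" using z assms by (subst ln_div) auto
  also have "\<dots> \<le> norm z / \<bar>u\<bar> - 1" using z assms by (intro ln_le_minus_one) auto
  also have "\<dots> = (norm z - \<bar>u\<bar>) / \<bar>u\<bar>" using assms by (simp add: diff_divide_distrib)
  also have "\<dots> \<le> 1 / \<bar>u\<bar>" using zu by (intro divide_right_mono) auto
  finally have "ln (norm z) - ln \<bar>u\<bar> \<le> 1 / \<bar>u\<bar>" .
  moreover have "ln (norm z) - ln \<bar>u\<bar> \<ge> 0"
  proof -
    have "0 < \<bar>u\<bar>" "0 < norm z" using zu assms by linarith+
    then show ?thesis using zu(1) by (subst diff_ge_0_iff_ge) (subst ln_le_cancel_iff)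
  qed
  ultimately have b2: "\<bar>ln (norm z) - ln \<bar>u\<bar>\<bar> \<le> 1 / \<bar>u\<bar>" by simp
  have "\<bar>a / 2 - b / 2 - c / 2\<bar> \<le> 2 * r" if "\<bar>a\<bar> \<le> r" "\<bar>b\<bar> \<le> r" "\<bar>c\<bar> \<le> r" for a b c r :: real
    using that by linarith
  from this[OF shift b2 b1] show ?thesis
    unfolding z_def[symmetric] X_def[symmetric] eq by simp
qed

section \<open>Asymptotics of the coefficients\<close>

text \<open>
The three Gamma factors in the denominator lie on the line of real part \<open>1 / 2\<close>, where they are
known exactly.
\<close>

lemma k_coeff_imaginary:
  fixes t1 t2 t :: real
  defines "G \<equiv> \<lambda>u. (norm (Gamma (Complex (1/4) u)))\<^sup>2"
  shows "k_coeff (\<i> * t1) (\<i> * t2) (\<i> * t) =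
    G ((t1 - t2 - t) / 4) * G ((- t1 + t2 - t) / 4) * G ((- t1 - t2 + t) / 4) * G ((- t1 - t2 - t) / 4) *
    (cosh (pi * t1 / 2) * cosh (pi * t2 / 2) * cosh (pi * t / 2)) / pi ^ 6"
proof -
  have H: "(norm (Gamma ((1 - \<i> * complex_of_real s) / 2)))\<^sup>2 = pi / cosh (pi * s / 2)" for s
  proof -
    have "(1 - \<i> * complex_of_real s) / 2 = Complex (1/2) (- s / 2)" by (simp add: complex_eq_iff)
    then show ?thesis using Gamma_norm_line_half[of "- s / 2"] by simp
  qed
  have e: "(1 + \<i> * t1 - \<i> * t2 - \<i> * t) / 4 = Complex (1/4) ((t1 - t2 - t) / 4)"
    "(1 - \<i> * t1 + \<i> * t2 - \<i> * t) / 4 = Complex (1/4) ((- t1 + t2 - t) / 4)"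
    "(1 - \<i> * t1 - \<i> * t2 + \<i> * t) / 4 = Complex (1/4) ((- t1 - t2 + t) / 4)"
    "(1 - \<i> * t1 - \<i> * t2 - \<i> * t) / 4 = Complex (1/4) ((- t1 - t2 - t) / 4)"
    by (simp_all add: complex_eq_iff)
  have "l_mod (\<i> * t1) (\<i> * t2) (\<i> * t) (e_vec (\<i> * t1)) (e_vec (\<i> * t2)) (e_vec (\<i> * t)) =
    of_real (sqrt pi / pi ^ 2) * (Gamma (Complex (1/4) ((t1 - t2 - t) / 4)) * Gamma (Complex (1/4) ((- t1 + t2 - t) / 4)) *
      Gamma (Complex (1/4) ((- t1 - t2 + t) / 4)) * Gamma (Complex (1/4) ((- t1 - t2 - t) / 4))) /
      (Gamma ((1 - \<i> * t1) / 2) * Gamma ((1 - \<i> * t2) / 2) * Gamma ((1 - \<i> * t) / 2))"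
    using l_mod_e_vec_Gamma[of "\<i> * t1" "\<i> * t2" "\<i> * t", unfolded e] by simp
  then have "k_coeff (\<i> * t1) (\<i> * t2) (\<i> * t) = (sqrt pi / pi ^ 2)\<^sup>2 *
    (G ((t1 - t2 - t) / 4) * G ((- t1 + t2 - t) / 4) * G ((- t1 - t2 + t) / 4) * G ((- t1 - t2 - t) / 4)) /
    ((pi / cosh (pi * t1 / 2)) * (pi / cosh (pi * t2 / 2)) * (pi / cosh (pi * t / 2)))"
    unfolding k_coeff_def G_def H[symmetric] by (simp only: norm_mult norm_divide norm_of_real power_mult_distrib power_divide power2_abs)
  also have "(sqrt pi / pi ^ 2)\<^sup>2 = 1 / pi ^ 3"
    by (simp add: power_divide field_simps flip: power_mult) (simp add: eval_nat_numeral)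
  finally show ?thesis by (simp add: field_simps eval_nat_numeral)
qed

lemma ln_abs_shift_bound:
  fixes t d w :: real
  assumes "\<bar>w - \<bar>t\<bar>\<bar> \<le> d" "2 * d \<le> \<bar>t\<bar>" "t \<noteq> 0"
  shows "\<bar>ln w - ln \<bar>t\<bar>\<bar> \<le> 2 * d / \<bar>t\<bar>"
proof -
  have w: "w > 0" using assms by linarith
  have b: "\<bar>(w - \<bar>t\<bar>) / \<bar>t\<bar>\<bar> \<le> d / \<bar>t\<bar>"
    using assms by (simp add: abs_divide divide_right_mono)
  moreover have "d / \<bar>t\<bar> \<le> 1 / 2" using assms by (simp add: field_simps)
  ultimately have "\<bar>ln (1 + (w - \<bar>t\<bar>) / \<bar>t\<bar>)\<bar> \<le> 2 * \<bar>(w - \<bar>t\<bar>) / \<bar>t\<bar>\<bar>"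
    by (intro abs_ln_one_plus_le) linarith
  also have "1 + (w - \<bar>t\<bar>) / \<bar>t\<bar> = w / \<bar>t\<bar>" using assms(3) by (simp add: field_simps)
  also have "ln (w / \<bar>t\<bar>) = ln w - ln \<bar>t\<bar>" using w assms(3) by (simp add: ln_div)
  finally show ?thesis using b by simp
qed

text \<open>
The logarithmic term of \<open>ln_Gamma_line_quarter\<close> may be evaluated at \<open>\<bar>t\<bar> / 4\<close> instead of the nearby
\<open>\<bar>u\<bar>\<close>, but the exponential term has to keep \<open>\<bar>u\<bar>\<close> itself, since there a bounded error
would become a constant factor.
\<close>

lemma ln_Gamma_line_quarter_shift:
  fixes t d u :: real
  assumes "\<bar>4 * \<bar>u\<bar> - \<bar>t\<bar>\<bar> \<le> d" "2 * d \<le> \<bar>t\<bar>" "\<bar>t\<bar> \<ge> 8"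
  shows "\<bar>ln ((norm (Gamma (Complex (1/4) u)))\<^sup>2) - (ln (2 * pi) - ln (\<bar>t\<bar> / 4) / 2 - pi * \<bar>u\<bar>)\<bar> \<le> (16 + d) / \<bar>t\<bar>"
proof -
  have u: "\<bar>u\<bar> \<ge> \<bar>t\<bar> / 8" using assms by linarith
  then have u1: "\<bar>u\<bar> \<ge> 1" using assms(3) by linarith
  have "2 / \<bar>u\<bar> \<le> 2 / (\<bar>t\<bar> / 8)"
    using u assms(3) by (intro divide_left_mono) auto
  then have Gamma_u: "\<bar>ln ((norm (Gamma (Complex (1/4) u)))\<^sup>2) - (ln (2 * pi) - ln \<bar>u\<bar> / 2 - pi * \<bar>u\<bar>)\<bar> \<le> 16 / \<bar>t\<bar>"
    using ln_Gamma_line_quarter[OF u1] by simp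
  have "\<bar>ln (4 * \<bar>u\<bar>) - ln \<bar>t\<bar>\<bar> \<le> 2 * d / \<bar>t\<bar>"
    using assms by (intro ln_abs_shift_bound) auto
  moreover have "ln (4 * \<bar>u\<bar>) = ln 4 + ln \<bar>u\<bar>" "ln (\<bar>t\<bar> / 4) = ln \<bar>t\<bar> - ln 4"
    using u1 assms(3) by (auto simp: ln_mult ln_div)
  ultimately have log: "\<bar>ln \<bar>u\<bar> - ln (\<bar>t\<bar> / 4)\<bar> \<le> 2 * d / \<bar>t\<bar>"
    by (simp only: diff_diff_eq2 add.commute)
  have "\<bar>x - (p - l / 2 - q)\<bar> \<le> e + e' / 2" if "\<bar>x - (p - l' / 2 - q)\<bar> \<le> e" "\<bar>l' - l\<bar> \<le> e'" for x p q l l' e e' :: real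
    using that by linarith
  from this[OF Gamma_u log] show ?thesis by (simp add: add_divide_distrib)
qed

text \<open>
Once \<open>t\<close> dominates, it determines the sign of each of the four terms, and the shifts cancel.
\<close>

lemma sum_abs_exponents:
  fixes t1 t2 t :: real
  assumes "\<bar>t1\<bar> + \<bar>t2\<bar> \<le> \<bar>t\<bar>"
  shows "\<bar>t1 - t2 - t\<bar> + \<bar>- t1 + t2 - t\<bar> + \<bar>- t1 - t2 + t\<bar> + \<bar>- t1 - t2 - t\<bar> = 4 * \<bar>t\<bar>"
  using assms by linarith

text \<open>
The four terms \<open>\<pi> * \<bar>u\<bar>\<close> add up to \<open>\<pi> * \<bar>t\<bar>\<close> by \<open>sum_abs_exponents\<close>, of which \<open>cosh (\<pi> * t / 2)\<close>
takes back one half. The four terms \<open>ln (\<bar>t\<bar> / 4) / 2\<close> make up the factor \<open>\<bar>t\<bar> powr (- 2)\<close>.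
In the error bound, each Gamma factor accounts for \<open>16 + \<bar>t1\<bar> + \<bar>t2\<bar>\<close> and the hyperbolic cosine for \<open>1\<close>.
\<close>

lemma ln_k_coeff_bound:
  fixes t1 t2 t :: real
  assumes t: "\<bar>t\<bar> \<ge> 8" "\<bar>t\<bar> \<ge> 2 * (\<bar>t1\<bar> + \<bar>t2\<bar>)"
  defines "L \<equiv> 4 * ln (2 * pi) + 2 * ln 4 - ln 2 + ln (cosh (pi * t1 / 2)) + ln (cosh (pi * t2 / 2)) - 6 * ln pi"
  shows "k_coeff (\<i> * t1) (\<i> * t2) (\<i> * t) > 0"
    and "\<bar>ln (k_coeff (\<i> * t1) (\<i> * t2) (\<i> * t)) - (L - 2 * ln \<bar>t\<bar> - pi / 2 * \<bar>t\<bar>)\<bar>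
      \<le> (65 + 4 * (\<bar>t1\<bar> + \<bar>t2\<bar>)) / \<bar>t\<bar>"
proof -
  define m where "m = \<bar>t1\<bar> + \<bar>t2\<bar>"
  define G where "G u = (norm (Gamma (Complex (1/4) u)))\<^sup>2" for u
  have G_pos: "G u > 0" for u
  proof -
    have "Complex (1/4) u \<notin> \<int>\<^sub>\<le>\<^sub>0" by (auto simp: complex_eq_iff elim!: nonpos_Ints_cases)
    then show ?thesis by (simp add: G_def Gamma_eq_zero_iff)
  qed
  define a where "a = (t1 - t2 - t) / 4"
  define b where "b = (- t1 + t2 - t) / 4"
  define c where "c = (- t1 - t2 + t) / 4"
  define d where "d = (- t1 - t2 - t) / 4"
  have k: "k_coeff (\<i> * t1) (\<i> * t2) (\<i> * t) = G a * G b * G c * G d *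
      (cosh (pi * t1 / 2) * cosh (pi * t2 / 2) * cosh (pi * t / 2)) / pi ^ 6"
    unfolding G_def a_def b_def c_def d_def by (rule k_coeff_imaginary)
  then show "k_coeff (\<i> * t1) (\<i> * t2) (\<i> * t) > 0"
    using G_pos by (simp add: cosh_real_pos)
  have ln_k: "ln (k_coeff (\<i> * t1) (\<i> * t2) (\<i> * t)) = ln (G a) + ln (G b) + ln (G c) + ln (G d) +
      ln (cosh (pi * t1 / 2)) + ln (cosh (pi * t2 / 2)) + ln (cosh (pi * t / 2)) - 6 * ln pi"
    unfolding k using G_pos[THEN less_imp_neq] by (simp add: ln_mult ln_div ln_realpow cosh_real_pos less_imp_neq[symmetric])
  have G_bound: "\<bar>ln (G u) - (ln (2 * pi) - ln (\<bar>t\<bar> / 4) / 2 - pi * \<bar>u\<bar>)\<bar> \<le> (16 + m) / \<bar>t\<bar>"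
    if "\<bar>4 * \<bar>u\<bar> - \<bar>t\<bar>\<bar> \<le> m" for u
    unfolding G_def using that t by (intro ln_Gamma_line_quarter_shift) (auto simp: m_def)
  have abcd: "4 * \<bar>a\<bar> = \<bar>t1 - t2 - t\<bar>" "4 * \<bar>b\<bar> = \<bar>- t1 + t2 - t\<bar>"
    "4 * \<bar>c\<bar> = \<bar>- t1 - t2 + t\<bar>" "4 * \<bar>d\<bar> = \<bar>- t1 - t2 - t\<bar>"
    by (simp_all add: a_def b_def c_def d_def)
  have b4: "\<bar>4 * \<bar>a\<bar> - \<bar>t\<bar>\<bar> \<le> m" "\<bar>4 * \<bar>b\<bar> - \<bar>t\<bar>\<bar> \<le> m" "\<bar>4 * \<bar>c\<bar> - \<bar>t\<bar>\<bar> \<le> m" "\<bar>4 * \<bar>d\<bar> - \<bar>t\<bar>\<bar> \<le> m"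
    unfolding abcd m_def by linarith+
  have "x \<le> y" if "2 * x \<le> y" "0 \<le> x" for x y :: real using that by linarith
  from this[OF t(2)] have "\<bar>t1\<bar> + \<bar>t2\<bar> \<le> \<bar>t\<bar>" by simp
  from sum_abs_exponents[OF this] have "\<bar>a\<bar> + \<bar>b\<bar> + \<bar>c\<bar> + \<bar>d\<bar> = \<bar>t\<bar>"
    unfolding abcd[symmetric] by (simp only: distrib_left[symmetric]) simp
  then have decay: "pi * \<bar>a\<bar> + pi * \<bar>b\<bar> + pi * \<bar>c\<bar> + pi * \<bar>d\<bar> = 2 * (pi / 2 * \<bar>t\<bar>)"
    by (simp flip: distrib_left)
  have cosh_t: "\<bar>ln (cosh (pi * t / 2)) - (pi / 2 * \<bar>t\<bar> - ln 2)\<bar> \<le> 1 / \<bar>t\<bar>"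
  proof -
    have "1 * \<bar>t\<bar> \<le> pi / 2 * \<bar>t\<bar>" using pi_gt3 by (intro mult_right_mono) auto
    then have "1 / \<bar>pi * t / 2\<bar> \<le> 1 / \<bar>t\<bar>"
      using t(1) by (intro divide_left_mono) (auto simp: abs_mult)
    moreover have "\<bar>ln (cosh (pi * t / 2)) - (\<bar>pi * t / 2\<bar> - ln 2)\<bar> \<le> 1 / \<bar>pi * t / 2\<bar>"
      using t(1) by (intro ln_cosh_bound) auto
    moreover have "\<bar>pi * t / 2\<bar> = pi / 2 * \<bar>t\<bar>" by (simp add: abs_mult)
    ultimately show ?thesis by simp
  qed
  have ln_t: "ln (\<bar>t\<bar> / 4) = ln \<bar>t\<bar> - ln 4" using t(1) by (simp add: ln_div)
  have combine: "\<bar>x1 + x2 + x3 + x4 + y1 + y2 + y3 - 6 * lp - (4 * P + 2 * q - l2 + y1 + y2 - 6 * lp - 2 * lt - h)\<bar> \<le> 4 * e + e'"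
    if "\<bar>x1 - (P - (lt - q) / 2 - p1)\<bar> \<le> e" "\<bar>x2 - (P - (lt - q) / 2 - p2)\<bar> \<le> e"
      "\<bar>x3 - (P - (lt - q) / 2 - p3)\<bar> \<le> e" "\<bar>x4 - (P - (lt - q) / 2 - p4)\<bar> \<le> e"
      "p1 + p2 + p3 + p4 = 2 * h" "\<bar>y3 - (h - l2)\<bar> \<le> e'"
    for x1 x2 x3 x4 y1 y2 y3 lp P q l2 lt h p1 p2 p3 p4 e e' :: real
  proof -
    define z1 z2 z3 z4 z5 where z: "z1 = x1 - (P - (lt - q) / 2 - p1)" "z2 = x2 - (P - (lt - q) / 2 - p2)"
      "z3 = x3 - (P - (lt - q) / 2 - p3)" "z4 = x4 - (P - (lt - q) / 2 - p4)" "z5 = y3 - (h - l2)"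
    have "x1 + x2 + x3 + x4 + y1 + y2 + y3 - 6 * lp - (4 * P + 2 * q - l2 + y1 + y2 - 6 * lp - 2 * lt - h) = z1 + z2 + z3 + z4 + z5"
      using that(5) unfolding z by (simp add: field_simps)
    also have "\<bar>\<dots>\<bar> \<le> \<bar>z1\<bar> + \<bar>z2\<bar> + \<bar>z3\<bar> + \<bar>z4\<bar> + \<bar>z5\<bar>" by linarith
    finally show ?thesis using that unfolding z by linarith
  qed
  have "\<bar>ln (k_coeff (\<i> * t1) (\<i> * t2) (\<i> * t)) - (L - 2 * ln \<bar>t\<bar> - pi / 2 * \<bar>t\<bar>)\<bar> \<le> 4 * ((16 + m) / \<bar>t\<bar>) + 1 / \<bar>t\<bar>"
    unfolding ln_k L_def using G_bound[OF b4(1)] G_bound[OF b4(2)] G_bound[OF b4(3)] G_bound[OF b4(4)]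
    unfolding ln_t by (rule combine) (rule decay, rule cosh_t)
  then show "\<bar>ln (k_coeff (\<i> * t1) (\<i> * t2) (\<i> * t)) - (L - 2 * ln \<bar>t\<bar> - pi / 2 * \<bar>t\<bar>)\<bar>
      \<le> (65 + 4 * (\<bar>t1\<bar> + \<bar>t2\<bar>)) / \<bar>t\<bar>"
    by (simp add: m_def add_divide_distrib)
qed

lemma abs_exp_minus_one_le:
  fixes x :: real
  assumes "\<bar>x\<bar> \<le> 1"
  shows "\<bar>exp x - 1\<bar> \<le> 2 * \<bar>x\<bar>"
proof (cases "x \<ge> 0")
  case True
  have "exp x \<le> 1 + x + x\<^sup>2" using True assms by (intro exp_bound) auto
  moreover have "x\<^sup>2 \<le> x" using True assms by (simp add: power2_eq_square mult_left_le)
  ultimately show ?thesis using True exp_ge_add_one_self[of x] by linarith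
next
  case False
  then have "exp x \<le> 1" by simp
  then show ?thesis using False exp_ge_add_one_self[of x] by linarith
qed

theorem proposition3p2:
  fixes \<tau> \<tau>' :: complex
  assumes "Re \<tau> = 0" and "Re \<tau>' = 0"
  shows "\<exists>c>0. \<exists>\<epsilon> :: complex \<Rightarrow> real.
           \<epsilon> \<in> O[at_imag_infinity](\<lambda>\<mu>. 1 / cmod \<mu>) \<and>
           (\<forall>\<^sub>F \<mu> in at_imag_infinity.
              k_coeff \<tau> \<tau>' \<mu> = c * exp (- (pi / 2) * cmod \<mu>) / (cmod \<mu>)\<^sup>2 * (1 + \<epsilon> \<mu>))"
proof -
  define t1 where "t1 = Im \<tau>"
  define t2 where "t2 = Im \<tau>'"
  have \<tau>: "\<tau> = \<i> * t1" "\<tau>' = \<i> * t2" using assms by (simp_all add: t1_def t2_def complex_eq_iff)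
  define L where "L = 4 * ln (2 * pi) + 2 * ln 4 - ln 2 + ln (cosh (pi * t1 / 2)) + ln (cosh (pi * t2 / 2)) - 6 * ln pi"
  define M where "M = 65 + 4 * (\<bar>t1\<bar> + \<bar>t2\<bar>)"
  define main where "main \<mu> = exp L * exp (- (pi / 2) * cmod \<mu>) / (cmod \<mu>)\<^sup>2" for \<mu>
  define \<epsilon> where "\<epsilon> \<mu> = k_coeff \<tau> \<tau>' \<mu> / main \<mu> - 1" for \<mu>
  (* The threshold M makes the error M / cmod \<mu> of the logarithm at most 1, where exp x - 1 is O(x). *)
  have bound: "main \<mu> > 0 \<and> \<bar>\<epsilon> \<mu>\<bar> \<le> 2 * M * (1 / cmod \<mu>)" if "cmod \<mu> \<ge> M" "Re \<mu> = 0" for \<mu>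
  proof -
    define t where "t = Im \<mu>"
    have \<mu>: "\<mu> = \<i> * t" using that by (simp add: t_def complex_eq_iff)
    have norm: "cmod \<mu> = \<bar>t\<bar>" by (simp add: \<mu> norm_mult)
    have t: "\<bar>t\<bar> \<ge> 8" "\<bar>t\<bar> \<ge> 2 * (\<bar>t1\<bar> + \<bar>t2\<bar>)" using that(1) by (auto simp: norm M_def)
    have main: "main \<mu> > 0" using t(1) by (auto simp: main_def norm)
    have "ln (main \<mu>) = L - 2 * ln \<bar>t\<bar> - pi / 2 * \<bar>t\<bar>"
    proof -
      have "ln (\<bar>t\<bar>\<^sup>2) = 2 * ln \<bar>t\<bar>" using t(1) by (subst ln_realpow) auto
      then show ?thesis
        unfolding main_def norm using t(1) by (simp add: ln_div ln_mult del: power2_abs)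
    qed
    then have x: "\<bar>ln (k_coeff \<tau> \<tau>' \<mu>) - ln (main \<mu>)\<bar> \<le> M / \<bar>t\<bar>"
      using ln_k_coeff_bound(2)[OF t] unfolding \<tau> \<mu> L_def M_def by simp
    have "k_coeff \<tau> \<tau>' \<mu> > 0" using ln_k_coeff_bound(1)[OF t] by (simp add: \<tau> \<mu>)
    with main have "\<epsilon> \<mu> = exp (ln (k_coeff \<tau> \<tau>' \<mu>) - ln (main \<mu>)) - 1"
      by (simp add: \<epsilon>_def exp_diff)
    moreover have "M / \<bar>t\<bar> \<le> 1" using that(1) t(1) by (simp add: norm field_simps)
    then have "\<bar>exp (ln (k_coeff \<tau> \<tau>' \<mu>) - ln (main \<mu>)) - 1\<bar> \<le> 2 * \<bar>ln (k_coeff \<tau> \<tau>' \<mu>) - ln (main \<mu>)\<bar>"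
      using x by (intro abs_exp_minus_one_le) linarith
    ultimately show ?thesis using x main by (simp add: norm)
  qed
  have ev: "\<forall>\<^sub>F \<mu> in at_imag_infinity. main \<mu> > 0 \<and> \<bar>\<epsilon> \<mu>\<bar> \<le> 2 * M * (1 / cmod \<mu>)"
    unfolding at_imag_infinity_def eventually_inf_principal eventually_at_infinity
    using bound by blast
  show ?thesis
  proof (intro exI[of _ "exp L"] exI[of _ \<epsilon>] conjI)
    show "\<epsilon> \<in> O[at_imag_infinity](\<lambda>\<mu>. 1 / cmod \<mu>)"
      by (rule bigoI[of _ "2 * M"]) (use ev in \<open>auto elim!: eventually_mono\<close>)
    show "\<forall>\<^sub>F \<mu> in at_imag_infinity. k_coeff \<tau> \<tau>' \<mu> = exp L * exp (- (pi / 2) * cmod \<mu>) / (cmod \<mu>)\<^sup>2 * (1 + \<epsilon> \<mu>)"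
      using ev
    proof eventually_elim
      case (elim \<mu>)
      then have "k_coeff \<tau> \<tau>' \<mu> = main \<mu> * (1 + \<epsilon> \<mu>)" by (simp add: \<epsilon>_def)
      then show ?case by (simp only: main_def)
    qed
  qed auto
qed

end
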